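(* Let $G$ be a finite group, $m$ a positive integer, $\Gamma=\mathrm{Cay}(G,S_{i,j}:1\le i,j\le m)$ an $m$-Cayley digraph of $G$, and $A=\mathrm{Aut}(\Gamma)$. With the sets $\tilde N,\tilde C,\tilde K,\tilde N_{1_r},\tilde N_{G_r},\tilde K_{1_r},\overline{\mathrm{S}}_m,\overline{\mathrm{Aut}}(G)$ defined in the context: (a) $N_A(R(G))=\tilde N$, $C_A(R(G))=\tilde C$, and the kernel of $\tilde N$ acting on $\{G_1,\dots,G_m\}$ is $\tilde K$. (b) For every $1\le r\le m$, $\tilde K_{1_r}$ and $\tilde N_{1_r}$ are the stabilizers of the vertex $1_r$ in $\tilde K$ and $\tilde N$, respectively, and $\tilde N_{G_r}$ is the setwise stabilizer of $G_r$ in $\tilde N$. (c) For every $1\le r\le m$, $\tilde K=R(G)\rtimes\tilde K_{1_r}$ and $\tilde N_{G_r}=R(G)\rtimes\tilde N_{1_r}$; moreover $\tilde N=\tilde K.\overline{\mathrm{S}}_m=\tilde C.\overline{\mathrm{Aut}}(G)$.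
   Context: Digraphs are finite without loops or multiple arcs. $V=\bigcup_{i=1}^m G_i$ is a disjoint union of copies $G_i=\{x_i:x\in G\}$ of $G$. For subsets $S_{i,j}\subseteq G$ ($1\le i,j\le m$) with $1\notin S_{i,i}$, the $m$-Cayley digraph $\mathrm{Cay}(G,S_{i,j}:1\le i,j\le m)$ has vertex set $V$ and arc set $\bigcup_{i,j}\{(x_i,(sx)_j): s\in S_{i,j},x\in G\}$. Permutations act on the right and products are composed left to right. $R(G)=\{R(g):g\in G\}$ with $R(g):x_i\mapsto(xg)_i$ for all $i$. For $g\in G$, $L_i(g)$ is the permutation of $V$ with $x_i\mapsto(g^{-1}x)_i$ and fixing all $x_j$ with $j\neq i$. $\sigma\in\mathrm{S}_m$ acts on $V$ by $x_i\mapsto x_{i^\sigma}$ and $\alpha\in\mathrm{Aut}(G)$ acts by $x_i\mapsto(x^\alpha)_i$. $(\mathrm{S}_m)_{G_r}$ is the subgroup of $\mathrm{S}_m$ fixing $G_r$ setwise, i.e. $\{\sigma\in \mathrm{S}_m: r^\sigma=r\}$. In the following sets, $g_1,\dots,g_m$ range over $G$, $\alpha$ over $\mathrm{Aut}(G)$, $\sigma$ over $\mathrm{S}_m$, and equations on the $S_{i,j}$ are required for all $1\le i,j\le m$: $\tilde N=\{L_1(g_1)\cdots L_m(g_m)\alpha\sigma : S_{i^\sigma,j^\sigma}=(g_j^{-1}S_{i,j}g_i)^\alpha\}$; $\tilde C=\{L_1(g_1)\cdots L_m(g_m)\sigma : S_{i^\sigma,j^\sigma}=g_j^{-1}S_{i,j}g_i\}$;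 $\tilde K=\{L_1(g_1)\cdots L_m(g_m)\alpha : S_{i,j}=(g_j^{-1}S_{i,j}g_i)^\alpha\}$; $\tilde N_{1_r}=\{L_1(g_1)\cdots L_m(g_m)\alpha\sigma : g_r=1,\ \sigma\in(\mathrm{S}_m)_{G_r},\ S_{i^\sigma,j^\sigma}=(g_j^{-1}S_{i,j}g_i)^\alpha\}$; $\tilde N_{G_r}=\{L_1(g_1)\cdots L_m(g_m)\alpha\sigma : \sigma\in(\mathrm{S}_m)_{G_r},\ S_{i^\sigma,j^\sigma}=(g_j^{-1}S_{i,j}g_i)^\alpha\}$; $\tilde K_{1_r}=\{L_1(g_1)\cdots L_m(g_m)\alpha : g_r=1,\ S_{i,j}=(g_j^{-1}S_{i,j}g_i)^\alpha\}$; $\overline{\mathrm{S}}_m=\{\sigma\in\mathrm{S}_m : L_1(g_1)\cdots L_m(g_m)\alpha\sigma\in\tilde N \text{ for some } g_1,\dots,g_m\in G,\ \alpha\in\mathrm{Aut}(G)\}$; $\overline{\mathrm{Aut}}(G)=\{\alpha\in\mathrm{Aut}(G) : L_1(g_1)\cdots L_m(g_m)\alpha\sigma\in\tilde N \text{ for some } g_1,\dots,g_m\in G,\ \sigma\in\mathrm{S}_m\}$. The notation $X=Y.Z$ means that $Y$ is a normal subgroup of $X$ with $X/Y\cong Z$ (not necessarily split). *)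

theory Defs
  imports "Graph_Theory.Pair_Digraph" "HOL-Algebra.Group_Action"
begin

section \<open>Permutation groups acting on the right\<close>

text \<open>
  Permutations act on the right, so the product \<open>f \<otimes> g\<close> means ``first \<open>f\<close>, then \<open>g\<close>''
  (the opposite of \<open>BijGroup\<close>). As in \<open>BijGroup\<close>, permutations of \<open>V\<close> are represented by
  functions that are \<open>undefined\<close> outside \<open>V\<close>. The image \<open>x\<^sup>f\<close> is written \<open>f x\<close>.
\<close>

definition perm_group :: "'v set \<Rightarrow> ('v \<Rightarrow> 'v) monoid" where
  "perm_group V = \<lparr>carrier = Bij V, monoid.mult = (\<lambda>f g. compose V g f), one = (\<lambda>x\<in>V. x)\<rparr>"

definition sym_gp :: "nat \<Rightarrow> (nat \<Rightarrow> nat) monoid" where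
  "sym_gp m = perm_group {1..m}"

definition aut_gp :: "('a, 'b) monoid_scheme \<Rightarrow> ('a \<Rightarrow> 'a) monoid" where
  "aut_gp G = (perm_group (carrier G))\<lparr>carrier := auto G\<rparr>"

definition digraph_aut :: "'v pair_pre_digraph \<Rightarrow> ('v \<Rightarrow> 'v) monoid" where
  "digraph_aut \<Gamma> = (perm_group (pverts \<Gamma>))\<lparr>carrier :=
     {f \<in> Bij (pverts \<Gamma>). \<forall>u \<in> pverts \<Gamma>. \<forall>v \<in> pverts \<Gamma>.
        (u, v) \<in> parcs \<Gamma> \<longleftrightarrow> (f u, f v) \<in> parcs \<Gamma>}\<rparr>"


section \<open>Centralizers, internal semidirect products and extensions\<close>

definition centralizer :: "('a, 'b) monoid_scheme \<Rightarrow> 'a set \<Rightarrow> 'a set" where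
  "centralizer G H = {x \<in> carrier G. \<forall>h \<in> H. x \<otimes>\<^bsub>G\<^esub> h = h \<otimes>\<^bsub>G\<^esub> x}"

definition internal_semidirect :: "('a, 'b) monoid_scheme \<Rightarrow> 'a set \<Rightarrow> 'a set \<Rightarrow> bool" where
  "internal_semidirect H Y Z \<longleftrightarrow>
     Y \<lhd> H \<and> subgroup Z H \<and> Y \<inter> Z = {\<one>\<^bsub>H\<^esub>} \<and> Y <#>\<^bsub>H\<^esub> Z = carrier H"

text \<open>\<open>H = Y.Z\<close>, with \<open>Y\<close> a subset of \<open>H\<close> and \<open>Z\<close> an abstract group.\<close>

definition is_extension :: "('a, 'b) monoid_scheme \<Rightarrow> 'a set \<Rightarrow> ('c, 'd) monoid_scheme \<Rightarrow> bool" where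
  "is_extension H Y Z \<longleftrightarrow> Y \<lhd> H \<and> group Z \<and> (H Mod Y) \<cong> Z"


section \<open>\<open>m\<close>-Cayley digraphs\<close>

text \<open>The vertex \<open>x\<^sub>i\<close> is the pair \<open>(x, i)\<close> with \<open>x \<in> carrier G\<close> and \<open>i \<in> {1..m}\<close>.\<close>

definition block :: "('a, 'b) monoid_scheme \<Rightarrow> nat \<Rightarrow> ('a \<times> nat) set" where
  "block G i = carrier G \<times> {i}"

definition mverts :: "('a, 'b) monoid_scheme \<Rightarrow> nat \<Rightarrow> ('a \<times> nat) set" where
  "mverts G m = (\<Union>i \<in> {1..m}. block G i)"

definition connection_sets :: "('a, 'b) monoid_scheme \<Rightarrow> nat \<Rightarrow> (nat \<Rightarrow> nat \<Rightarrow> 'a set) \<Rightarrow> bool" where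
  "connection_sets G m S \<longleftrightarrow>
     (\<forall>i \<in> {1..m}. \<forall>j \<in> {1..m}. S i j \<subseteq> carrier G) \<and> (\<forall>i \<in> {1..m}. \<one>\<^bsub>G\<^esub> \<notin> S i i)"

definition mCay :: "('a, 'b) monoid_scheme \<Rightarrow> nat \<Rightarrow> (nat \<Rightarrow> nat \<Rightarrow> 'a set) \<Rightarrow> ('a \<times> nat) pair_pre_digraph" where
  "mCay G m S = \<lparr>pverts = mverts G m,
     parcs = (\<Union>i \<in> {1..m}. \<Union>j \<in> {1..m}.
       {((x, i), (s \<otimes>\<^bsub>G\<^esub> x, j)) | s x. s \<in> S i j \<and> x \<in> carrier G})\<rparr>"

lemma pair_digraph_mCay:
  assumes "group G" "finite (carrier G)" "connection_sets G m S"
  shows "pair_digraph (mCay G m S)"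
proof -
  interpret group G by fact
  have S: "s \<in> carrier G" if "s \<in> S i j" "i \<in> {1..m}" "j \<in> {1..m}" for s i j
    using assms(3) that unfolding connection_sets_def by blast
  have fin: "finite (mverts G m)"
    using assms(2) by (auto simp: mverts_def block_def)
  have arc: "\<exists>i j s x. e = ((x, i), (s \<otimes>\<^bsub>G\<^esub> x, j)) \<and> i \<in> {1..m} \<and> j \<in> {1..m} \<and>
      s \<in> S i j \<and> x \<in> carrier G" if "e \<in> parcs (mCay G m S)" for e
    using that unfolding mCay_def pair_pre_digraph.simps by blast
  have sub: "parcs (mCay G m S) \<subseteq> mverts G m \<times> mverts G m"
  proof
    fix e assume "e \<in> parcs (mCay G m S)"
    then obtain i j s x where *: "e = ((x, i), (s \<otimes>\<^bsub>G\<^esub> x, j))" "i \<in> {1..m}" "j \<in> {1..m}"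
      "s \<in> S i j" "x \<in> carrier G" using arc by blast
    moreover have "s \<otimes>\<^bsub>G\<^esub> x \<in> carrier G" using S * by blast
    ultimately show "e \<in> mverts G m \<times> mverts G m"
      unfolding mverts_def block_def by blast
  qed
  have loop: "fst e \<noteq> snd e" if e: "e \<in> parcs (mCay G m S)" for e
  proof
    assume eq: "fst e = snd e"
    obtain i j s x where *: "e = ((x, i), (s \<otimes>\<^bsub>G\<^esub> x, j))" "i \<in> {1..m}" "j \<in> {1..m}"
      "s \<in> S i j" "x \<in> carrier G" using arc[OF e] by blast
    have "j = i" "s \<otimes>\<^bsub>G\<^esub> x = x" using eq *(1) by simp_all
    then have "s = \<one>\<^bsub>G\<^esub>" using S[OF *(4) *(2) *(3)] *(5) r_cancel_one[of x s] by simp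
    with *(2,4) \<open>j = i\<close> assms(3) show False unfolding connection_sets_def by blast
  qed
  have pv: "pverts (mCay G m S) = mverts G m" by (simp add: mCay_def)
  show ?thesis
  proof
    show "finite (pverts (mCay G m S))" using fin pv by simp
    show "finite (parcs (mCay G m S))" using finite_subset[OF sub] fin by simp
  next
    fix e assume e: "e \<in> parcs (mCay G m S)"
    then have "e \<in> mverts G m \<times> mverts G m" using sub by blast
    then show "fst e \<in> pverts (mCay G m S)" "snd e \<in> pverts (mCay G m S)"
      unfolding pv by (simp_all add: mem_Times_iff)
    show "fst e \<noteq> snd e" using loop[OF e] .
  qed
qed

definition R_act :: "('a, 'b) monoid_scheme \<Rightarrow> nat \<Rightarrow> 'a \<Rightarrow> 'a \<times> nat \<Rightarrow> 'a \<times> nat" where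
  "R_act G m g = (\<lambda>(x, i) \<in> mverts G m. (x \<otimes>\<^bsub>G\<^esub> g, i))"

definition RG :: "('a, 'b) monoid_scheme \<Rightarrow> nat \<Rightarrow> ('a \<times> nat \<Rightarrow> 'a \<times> nat) set" where
  "RG G m = R_act G m ` carrier G"

definition L_act :: "('a, 'b) monoid_scheme \<Rightarrow> nat \<Rightarrow> nat \<Rightarrow> 'a \<Rightarrow> 'a \<times> nat \<Rightarrow> 'a \<times> nat" where
  "L_act G m i g = (\<lambda>(x, j) \<in> mverts G m. if j = i then (inv\<^bsub>G\<^esub> g \<otimes>\<^bsub>G\<^esub> x, j) else (x, j))"

definition act_sym :: "('a, 'b) monoid_scheme \<Rightarrow> nat \<Rightarrow> (nat \<Rightarrow> nat) \<Rightarrow> 'a \<times> nat \<Rightarrow> 'a \<times> nat" where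
  "act_sym G m \<sigma> = (\<lambda>(x, i) \<in> mverts G m. (x, \<sigma> i))"

definition act_aut :: "('a, 'b) monoid_scheme \<Rightarrow> nat \<Rightarrow> ('a \<Rightarrow> 'a) \<Rightarrow> 'a \<times> nat \<Rightarrow> 'a \<times> nat" where
  "act_aut G m \<alpha> = (\<lambda>(x, i) \<in> mverts G m. (\<alpha> x, i))"

text \<open>The products \<open>L\<^sub>1(g\<^sub>1) \<cdots> L\<^sub>m(g\<^sub>m)\<close>, taken in the symmetric group on the vertices.\<close>

definition Lprod :: "('a, 'b) monoid_scheme \<Rightarrow> nat \<Rightarrow> (nat \<Rightarrow> 'a) \<Rightarrow> 'a \<times> nat \<Rightarrow> 'a \<times> nat" where
  "Lprod G m g =
     foldr (\<lambda>i f. L_act G m i (g i) \<otimes>\<^bsub>perm_group (mverts G m)\<^esub> f) [1..<Suc m] \<one>\<^bsub>perm_group (mverts G m)\<^esub>"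

definition LA :: "('a, 'b) monoid_scheme \<Rightarrow> nat \<Rightarrow> (nat \<Rightarrow> 'a) \<Rightarrow> ('a \<Rightarrow> 'a) \<Rightarrow> 'a \<times> nat \<Rightarrow> 'a \<times> nat" where
  "LA G m g \<alpha> = Lprod G m g \<otimes>\<^bsub>perm_group (mverts G m)\<^esub> act_aut G m \<alpha>"

definition LS :: "('a, 'b) monoid_scheme \<Rightarrow> nat \<Rightarrow> (nat \<Rightarrow> 'a) \<Rightarrow> (nat \<Rightarrow> nat) \<Rightarrow> 'a \<times> nat \<Rightarrow> 'a \<times> nat" where
  "LS G m g \<sigma> = Lprod G m g \<otimes>\<^bsub>perm_group (mverts G m)\<^esub> act_sym G m \<sigma>"

definition LAS :: "('a, 'b) monoid_scheme \<Rightarrow> nat \<Rightarrow> (nat \<Rightarrow> 'a) \<Rightarrow> ('a \<Rightarrow> 'a) \<Rightarrow> (nat \<Rightarrow> nat) \<Rightarrow> 'a \<times> nat \<Rightarrow> 'a \<times> nat" where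
  "LAS G m g \<alpha> \<sigma> = LA G m g \<alpha> \<otimes>\<^bsub>perm_group (mverts G m)\<^esub> act_sym G m \<sigma>"

text \<open>The set \<open>g\<^sub>j\<inverse> S\<^sub>i\<^sub>j g\<^sub>i\<close>.\<close>

definition twist :: "('a, 'b) monoid_scheme \<Rightarrow> (nat \<Rightarrow> nat \<Rightarrow> 'a set) \<Rightarrow> (nat \<Rightarrow> 'a) \<Rightarrow> nat \<Rightarrow> nat \<Rightarrow> 'a set" where
  "twist G S g i j = inv\<^bsub>G\<^esub> (g j) <#\<^bsub>G\<^esub> S i j #>\<^bsub>G\<^esub> g i"

definition Ntilde where
  "Ntilde G m S = {LAS G m g \<alpha> \<sigma> | g \<alpha> \<sigma>.
     g \<in> {1..m} \<rightarrow> carrier G \<and> \<alpha> \<in> carrier (aut_gp G) \<and> \<sigma> \<in> carrier (sym_gp m) \<and>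
     (\<forall>i \<in> {1..m}. \<forall>j \<in> {1..m}. S (\<sigma> i) (\<sigma> j) = \<alpha> ` twist G S g i j)}"

definition Ctilde where
  "Ctilde G m S = {LS G m g \<sigma> | g \<sigma>.
     g \<in> {1..m} \<rightarrow> carrier G \<and> \<sigma> \<in> carrier (sym_gp m) \<and>
     (\<forall>i \<in> {1..m}. \<forall>j \<in> {1..m}. S (\<sigma> i) (\<sigma> j) = twist G S g i j)}"

definition Ktilde where
  "Ktilde G m S = {LA G m g \<alpha> | g \<alpha>.
     g \<in> {1..m} \<rightarrow> carrier G \<and> \<alpha> \<in> carrier (aut_gp G) \<and>
     (\<forall>i \<in> {1..m}. \<forall>j \<in> {1..m}. S i j = \<alpha> ` twist G S g i j)}"

definition Ntilde_vertex where
  "Ntilde_vertex G m S r = {LAS G m g \<alpha> \<sigma> | g \<alpha> \<sigma>.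
     g \<in> {1..m} \<rightarrow> carrier G \<and> \<alpha> \<in> carrier (aut_gp G) \<and> \<sigma> \<in> carrier (sym_gp m) \<and>
     g r = \<one>\<^bsub>G\<^esub> \<and> \<sigma> r = r \<and>
     (\<forall>i \<in> {1..m}. \<forall>j \<in> {1..m}. S (\<sigma> i) (\<sigma> j) = \<alpha> ` twist G S g i j)}"

definition Ntilde_block where
  "Ntilde_block G m S r = {LAS G m g \<alpha> \<sigma> | g \<alpha> \<sigma>.
     g \<in> {1..m} \<rightarrow> carrier G \<and> \<alpha> \<in> carrier (aut_gp G) \<and> \<sigma> \<in> carrier (sym_gp m) \<and>
     \<sigma> r = r \<and>
     (\<forall>i \<in> {1..m}. \<forall>j \<in> {1..m}. S (\<sigma> i) (\<sigma> j) = \<alpha> ` twist G S g i j)}"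

definition Ktilde_vertex where
  "Ktilde_vertex G m S r = {LA G m g \<alpha> | g \<alpha>.
     g \<in> {1..m} \<rightarrow> carrier G \<and> \<alpha> \<in> carrier (aut_gp G) \<and> g r = \<one>\<^bsub>G\<^esub> \<and>
     (\<forall>i \<in> {1..m}. \<forall>j \<in> {1..m}. S i j = \<alpha> ` twist G S g i j)}"

definition Sbar where
  "Sbar G m S = {\<sigma> \<in> carrier (sym_gp m). \<exists>g \<alpha>.
     g \<in> {1..m} \<rightarrow> carrier G \<and> \<alpha> \<in> carrier (aut_gp G) \<and> LAS G m g \<alpha> \<sigma> \<in> Ntilde G m S}"

definition Autbar where
  "Autbar G m S = {\<alpha> \<in> carrier (aut_gp G). \<exists>g \<sigma>.
     g \<in> {1..m} \<rightarrow> carrier G \<and> \<sigma> \<in> carrier (sym_gp m) \<and> LAS G m g \<alpha> \<sigma> \<in> Ntilde G m S}"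

definition blocks :: "('a, 'b) monoid_scheme \<Rightarrow> nat \<Rightarrow> ('a \<times> nat) set set" where
  "blocks G m = block G ` {1..m}"

definition block_action ::
  "('a, 'b) monoid_scheme \<Rightarrow> nat \<Rightarrow> ('a \<times> nat \<Rightarrow> 'a \<times> nat) \<Rightarrow> ('a \<times> nat) set \<Rightarrow> ('a \<times> nat) set" where
  "block_action G m f = (\<lambda>B \<in> blocks G m. f ` B)"

end

theory Submission
  imports Defs "HOL-Algebra.Zassenhaus"
begin

text \<open>
  A permutation \<open>f\<close> of the vertices normalizes \<open>R(G)\<close> exactly when there is a permutation
  \<open>\<alpha>\<close> of \<open>G\<close> with \<open>R(a) f = f R(\<alpha> a)\<close> for all \<open>a\<close>. Since \<open>R(G)\<close> is regular on each
  copy of \<open>G\<close>, the map \<open>f\<close> is then determined by \<open>\<alpha>\<close> and by the images of the identity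
  vertices: writing \<open>(\<one>, i) \<mapsto> (c\<^sub>i, \<sigma> i)\<close> one gets \<open>(x, i) \<mapsto> (c\<^sub>i \<otimes> \<alpha> x, \<sigma> i)\<close>.
  Bijectivity of \<open>f\<close> makes \<open>\<alpha>\<close> an automorphism of \<open>G\<close> and \<open>\<sigma>\<close> a permutation of the
  indices, and choosing \<open>g\<^sub>i\<close> with \<open>\<alpha> (g\<^sub>i\<inverse>) = c\<^sub>i\<close> turns \<open>f\<close> into
  \<open>L\<^sub>1(g\<^sub>1) \<cdots> L\<^sub>m(g\<^sub>m) \<alpha> \<sigma>\<close> (\<open>intertwining_imp_LAS\<close>). On the other hand, an arc with
  quotient \<open>s\<close> from copy \<open>i\<close> to copy \<open>j\<close> is sent by such a product to a pair with quotient
  \<open>\<alpha> (g\<^sub>j\<inverse> s g\<^sub>i)\<close> from copy \<open>\<sigma> i\<close> to copy \<open>\<sigma> j\<close>, so that it is an automorphism of the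
  digraph precisely under the stated condition on the connection sets
  (\<open>LAS_digraph_aut_iff\<close>). The two facts together give the normalizer; the centralizer is
  the case \<open>\<alpha> = id\<close>.

  The factors \<open>\<alpha>\<close> and \<open>\<sigma>\<close> can be read off from the map, and both assignments are
  homomorphisms on the normalizer (\<open>group_part_hom\<close>, \<open>block_perm_hom\<close>). Their kernels are
  the centralizer and the kernel of the action on the blocks, their images the groups
  \<open>Autbar\<close> and \<open>Sbar\<close>, and the first isomorphism theorem yields both extensions. Finally,
  any group between \<open>R(G)\<close> and its normalizer that fixes a block setwise is the semidirect
  product of \<open>R(G)\<close> with a vertex stabilizer, because \<open>R(G)\<close> is already regular on that
  block (\<open>semidirect_vertex_stabilizer\<close>).
\<close>

section \<open>Permutation groups and extensions\<close>

lemma perm_group_simps [simp]: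
  "carrier (perm_group V) = Bij V"
  "f \<otimes>\<^bsub>perm_group V\<^esub> h = compose V h f"
  "\<one>\<^bsub>perm_group V\<^esub> = (\<lambda>x\<in>V. x)"
  by (simp_all add: perm_group_def)

lemma group_perm_group: "group (perm_group V)"
proof (rule groupI)
  fix f assume "f \<in> carrier (perm_group V)"
  then have f: "f \<in> Bij V" by simp
  have "compose V f (\<lambda>x\<in>V. inv_into V f x) = (\<lambda>x\<in>V. x)"
    using f by (auto simp: compose_def Bij_def bij_betw_def f_inv_into_f fun_eq_iff)
  then show "\<exists>h\<in>carrier (perm_group V). h \<otimes>\<^bsub>perm_group V\<^esub> f = \<one>\<^bsub>perm_group V\<^esub>"
    using restrict_inv_into_Bij[OF f] by auto
next
  fix f assume "f \<in> carrier (perm_group V)"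
  then show "\<one>\<^bsub>perm_group V\<^esub> \<otimes>\<^bsub>perm_group V\<^esub> f = f"
    by (auto simp: fun_eq_iff compose_def Bij_def extensional_def)
next
  fix f h k
  assume "f \<in> carrier (perm_group V)" "h \<in> carrier (perm_group V)" "k \<in> carrier (perm_group V)"
  then show "f \<otimes>\<^bsub>perm_group V\<^esub> h \<otimes>\<^bsub>perm_group V\<^esub> k =
      f \<otimes>\<^bsub>perm_group V\<^esub> (h \<otimes>\<^bsub>perm_group V\<^esub> k)"
    by (auto simp: fun_eq_iff compose_def dest!: Bij_imp_funcset)
qed (auto simp: compose_Bij id_Bij)

lemma inv_perm_group:
  assumes "f \<in> Bij V"
  shows "inv\<^bsub>perm_group V\<^esub> f = (\<lambda>x\<in>V. inv_into V f x)"
proof (rule group.inv_equality[OF group_perm_group])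
  show "(\<lambda>x\<in>V. inv_into V f x) \<otimes>\<^bsub>perm_group V\<^esub> f = \<one>\<^bsub>perm_group V\<^esub>"
    using assms by (auto simp: compose_def Bij_def bij_betw_def f_inv_into_f fun_eq_iff)
qed (use assms restrict_inv_into_Bij[OF assms] in \<open>simp_all del: restrict_apply\<close>)

lemma digraph_aut_simps [simp]:
  "f \<otimes>\<^bsub>digraph_aut \<Gamma>\<^esub> h = compose (pverts \<Gamma>) h f"
  "\<one>\<^bsub>digraph_aut \<Gamma>\<^esub> = (\<lambda>x\<in>pverts \<Gamma>. x)"
  by (simp_all add: digraph_aut_def perm_group_def)

lemma group_digraph_aut: "group (digraph_aut \<Gamma>)"
proof -
  let ?V = "pverts \<Gamma>"
  let ?A = "{f \<in> Bij ?V. \<forall>u \<in> ?V. \<forall>v \<in> ?V. (u, v) \<in> parcs \<Gamma> \<longleftrightarrow> (f u, f v) \<in> parcs \<Gamma>}"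
  have "subgroup ?A (perm_group ?V)"
  proof (rule group.subgroupI[OF group_perm_group])
    show "?A \<noteq> {}"
      using id_Bij[of ?V] by auto
  next
    fix f assume f: "f \<in> ?A"
    then have "inv_into ?V f v \<in> ?V" "f (inv_into ?V f v) = v" if "v \<in> ?V" for v
      using that by (auto simp: Bij_def bij_betw_def inv_into_into f_inv_into_f)
    with f show "inv\<^bsub>perm_group ?V\<^esub> f \<in> ?A"
      by (auto simp: inv_perm_group restrict_inv_into_Bij simp del: restrict_apply)
        (simp_all)
  next
    fix f h assume fh: "f \<in> ?A" "h \<in> ?A"
    then have "f v \<in> ?V" if "v \<in> ?V" for v
      using that by (auto dest: Bij_imp_funcset)
    then have "(u, v) \<in> parcs \<Gamma> \<longleftrightarrow> (h (f u), h (f v)) \<in> parcs \<Gamma>" if "u \<in> ?V" "v \<in> ?V" for u v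
      using that fh by blast
    moreover have "compose ?V h f \<in> Bij ?V" using fh by (simp add: compose_Bij)
    ultimately show "f \<otimes>\<^bsub>perm_group ?V\<^esub> h \<in> ?A"
      by (simp add: compose_eq)
  qed auto
  then show ?thesis
    unfolding digraph_aut_def by (rule subgroup.subgroup_is_group[OF _ group_perm_group])
qed

lemma (in group) group_aut_gp: "group (aut_gp G)"
proof -
  have "subgroup (auto G) (perm_group (carrier G))"
  proof (rule group.subgroupI[OF group_perm_group])
    show "auto G \<noteq> {}" using id_in_auto by blast
  next
    fix f assume "f \<in> auto G"
    then show "inv\<^bsub>perm_group (carrier G)\<^esub> f \<in> auto G"
      by (auto simp: auto_def inv_perm_group restrict_inv_into_Bij restrict_inv_into_hom
          simp del: restrict_apply)
  next
    fix f h assume "f \<in> auto G" "h \<in> auto G"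
    then show "f \<otimes>\<^bsub>perm_group (carrier G)\<^esub> h \<in> auto G"
      by (auto simp: auto_def compose_Bij hom_compose)
  qed (auto simp: auto_def)
  then show ?thesis
    unfolding aut_gp_def by (rule subgroup.subgroup_is_group[OF _ group_perm_group])
qed

lemma aut_gp_simps [simp]:
  "carrier (aut_gp G) = auto G"
  "f \<otimes>\<^bsub>aut_gp G\<^esub> h = compose (carrier G) h f"
  "\<one>\<^bsub>aut_gp G\<^esub> = (\<lambda>x\<in>carrier G. x)"
  by (simp_all add: aut_gp_def perm_group_def)

text \<open>
  This form avoids inverses of permutations, so that membership in the normalizer becomes a
  family of equations between products.
\<close>

lemma (in group) normalizer_iff_commutes:
  assumes "H \<subseteq> carrier G"
  shows "x \<in> normalizer G H \<longleftrightarrow> x \<in> carrier G \<and> x <# H = H #> x"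
proof (cases "x \<in> carrier G")
  case True
  have sub: "x <# H \<subseteq> carrier G" using True assms by (rule l_coset_subset_G[rotated])
  have "x <# H #> inv x = H \<longleftrightarrow> x <# H = H #> x"
  proof
    assume "x <# H #> inv x = H"
    then have "H #> x = x <# H #> inv x #> x" by simp
    then show "x <# H = H #> x"
      using True sub by (simp add: coset_mult_assoc)
  next
    assume "x <# H = H #> x"
    then show "x <# H #> inv x = H"
      using True assms by (simp add: coset_mult_assoc)
  qed
  then show ?thesis
    using True assms by (simp add: normalizer_def stabilizer_def)
qed (simp add: normalizer_def stabilizer_def)

lemma (in group_hom) kernel_extension:
  "is_extension G (kernel G H h) (H\<lparr>carrier := h ` carrier G\<rparr>)"
proof -
  interpret I: group_hom G "H\<lparr>carrier := h ` carrier G\<rparr>" h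
    using induced_group_hom[OF G.subgroup_self] by simp
  have "kernel G (H\<lparr>carrier := h ` carrier G\<rparr>) h = kernel G H h"
    by (simp add: kernel_def)
  then show ?thesis
    unfolding is_extension_def using I.normal_kernel I.H.group_axioms I.FactGroup_iso by simp
qed


section \<open>Products of translations, automorphisms and index permutations\<close>

lemma mverts_iff [simp]: "(x, i) \<in> mverts G m \<longleftrightarrow> x \<in> carrier G \<and> i \<in> {1..m}"
  by (auto simp: mverts_def block_def)

lemma autoD:
  assumes "\<alpha> \<in> auto G"
  shows "x \<in> carrier G \<Longrightarrow> \<alpha> x \<in> carrier G"
    and "x \<in> carrier G \<Longrightarrow> y \<in> carrier G \<Longrightarrow> \<alpha> (x \<otimes>\<^bsub>G\<^esub> y) = \<alpha> x \<otimes>\<^bsub>G\<^esub> \<alpha> y"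
    and "inj_on \<alpha> (carrier G)"
    and "\<alpha> ` carrier G = carrier G"
    and "\<alpha> \<in> extensional (carrier G)"
  using assms by (auto simp: auto_def hom_def Bij_def bij_betw_def)

lemma (in group) auto_inv:
  assumes "\<alpha> \<in> auto G" "x \<in> carrier G"
  shows "\<alpha> (inv x) = inv (\<alpha> x)" and "\<alpha> \<one> = \<one>"
proof -
  interpret group_hom G G \<alpha>
    using assms(1) by unfold_locales (simp add: auto_def)
  show "\<alpha> (inv x) = inv (\<alpha> x)" "\<alpha> \<one> = \<one>" using assms(2) by simp_all
qed

lemma BijD:
  assumes "\<sigma> \<in> Bij X"
  shows "i \<in> X \<Longrightarrow> \<sigma> i \<in> X" "inj_on \<sigma> X" "\<sigma> ` X = X" "\<sigma> \<in> extensional X"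
  using assms by (auto simp: Bij_def bij_betw_def)

locale m_cayley = group G for G (structure) +
  fixes m :: nat and S :: "nat \<Rightarrow> nat \<Rightarrow> 'a set"
  assumes m_pos: "m \<ge> 1"
    and conn: "connection_sets G m S"
begin

abbreviation A where "A \<equiv> digraph_aut (mCay G m S)"
abbreviation N where "N \<equiv> Ntilde G m S"

text \<open>
  The triples that parametrize the products \<open>L\<^sub>1(g\<^sub>1) \<cdots> L\<^sub>m(g\<^sub>m) \<alpha> \<sigma>\<close>; the condition on the
  connection sets is kept apart, since it only expresses that the product preserves arcs.
\<close>

definition parameters :: "(nat \<Rightarrow> 'a) \<Rightarrow> ('a \<Rightarrow> 'a) \<Rightarrow> (nat \<Rightarrow> nat) \<Rightarrow> bool" where
  "parameters g \<alpha> \<sigma> \<longleftrightarrow> g \<in> {1..m} \<rightarrow> carrier G \<and> \<alpha> \<in> auto G \<and> \<sigma> \<in> Bij {1..m}"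

lemma parametersD:
  assumes "parameters g \<alpha> \<sigma>"
  shows "\<alpha> \<in> auto G" "\<sigma> \<in> Bij {1..m}" "g \<in> {1..m} \<rightarrow> carrier G"
    "i \<in> {1..m} \<Longrightarrow> g i \<in> carrier G" "i \<in> {1..m} \<Longrightarrow> \<sigma> i \<in> {1..m}"
  using assms BijD[of \<sigma> "{1..m}"] by (auto simp: parameters_def)

lemma pverts_mCay [simp]: "pverts (mCay G m S) = mverts G m"
  by (simp add: mCay_def)

lemma connD: "i \<in> {1..m} \<Longrightarrow> j \<in> {1..m} \<Longrightarrow> S i j \<subseteq> carrier G"
  using conn by (simp add: connection_sets_def)

text \<open>
  An arc is determined by its end copies and the quotient of its ends, which is why maps
  acting well on quotients are easy to test for being automorphisms.
\<close>

lemma arc_iff: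
  "((x, i), (y, j)) \<in> parcs (mCay G m S) \<longleftrightarrow>
     i \<in> {1..m} \<and> j \<in> {1..m} \<and> x \<in> carrier G \<and> y \<in> carrier G \<and> y \<otimes> inv x \<in> S i j"
  (is "?L \<longleftrightarrow> ?R")
proof
  assume ?L
  then obtain s where "y = s \<otimes> x" "i \<in> {1..m}" "j \<in> {1..m}" "s \<in> S i j" "x \<in> carrier G"
    by (auto simp: mCay_def)
  then show ?R using connD[of i j] by (auto simp: m_assoc)
next
  assume R: ?R
  then have "y = (y \<otimes> inv x) \<otimes> x" by (simp add: m_assoc)
  with R have "\<exists>s. y = s \<otimes> x \<and> s \<in> S i j \<and> x \<in> carrier G" by blast
  with R show ?L by (auto simp: mCay_def)
qed

text \<open>
  The factors \<open>L\<^sub>i(g\<^sub>i)\<close> move pairwise disjoint copies, so that a partial product translates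
  just the copies whose index has occurred; distinctness prevents a repeated translation.
\<close>

lemma Lprod_foldr:
  assumes "distinct is" "set is \<subseteq> {1..m}" "g \<in> {1..m} \<rightarrow> carrier G"
  shows "foldr (\<lambda>i f. L_act G m i (g i) \<otimes>\<^bsub>perm_group (mverts G m)\<^esub> f) is \<one>\<^bsub>perm_group (mverts G m)\<^esub>
    = (\<lambda>(x, j) \<in> mverts G m. (if j \<in> set is then inv (g j) \<otimes> x else x, j))"
  using assms
proof (induction "is")
  case Nil
  then show ?case by (auto simp: fun_eq_iff)
next
  case (Cons i "is")
  then have "g i \<in> carrier G" by auto
  with Cons show ?case
    by (auto simp: fun_eq_iff compose_def L_act_def)
qed

lemma Lprod_eq:
  assumes "g \<in> {1..m} \<rightarrow> carrier G"
  shows "Lprod G m g = (\<lambda>(x, i) \<in> mverts G m. (inv (g i) \<otimes> x, i))"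
  unfolding Lprod_def
  by (subst Lprod_foldr) (use assms in \<open>auto simp: fun_eq_iff restrict_def simp del: upt_Suc\<close>)

lemma LAS_eq:
  assumes "parameters g \<alpha> \<sigma>"
  shows "LAS G m g \<alpha> \<sigma> = (\<lambda>(x, i) \<in> mverts G m. (\<alpha> (inv (g i) \<otimes> x), \<sigma> i))"
  using parametersD[OF assms] autoD(1)[of \<alpha> G]
  by (auto simp: fun_eq_iff LAS_def LA_def Lprod_eq compose_def act_aut_def act_sym_def Pi_iff)

lemma LAS_apply:
  assumes "parameters g \<alpha> \<sigma>" "x \<in> carrier G" "i \<in> {1..m}"
  shows "LAS G m g \<alpha> \<sigma> (x, i) = (\<alpha> (inv (g i) \<otimes> x), \<sigma> i)"
  using assms by (simp add: LAS_eq)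

lemma LA_eq_LAS:
  assumes "g \<in> {1..m} \<rightarrow> carrier G" "\<alpha> \<in> auto G"
  shows "LA G m g \<alpha> = LAS G m g \<alpha> (\<lambda>i\<in>{1..m}. i)"
  using assms autoD(1)[of \<alpha> G]
  by (auto simp: fun_eq_iff LAS_def LA_def Lprod_eq compose_def act_aut_def act_sym_def Pi_iff)

lemma LS_eq_LAS:
  assumes "g \<in> {1..m} \<rightarrow> carrier G"
  shows "LS G m g \<sigma> = LAS G m g (\<lambda>x\<in>carrier G. x) \<sigma>"
  using assms
  by (auto simp: fun_eq_iff LAS_def LS_def LA_def Lprod_eq compose_def act_aut_def act_sym_def Pi_iff)

lemma LAS_Bij:
  assumes p: "parameters g \<alpha> \<sigma>"
  shows "LAS G m g \<alpha> \<sigma> \<in> Bij (mverts G m)"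
proof -
  note pD = parametersD[OF p]
  note a = autoD[OF pD(1)]
  let ?f = "LAS G m g \<alpha> \<sigma>"
  have "inj_on ?f (mverts G m)"
  proof (rule inj_onI, clarify)
    fix x i y j assume xi: "(x, i) \<in> mverts G m" and yj: "(y, j) \<in> mverts G m"
      and eq: "?f (x, i) = ?f (y, j)"
    then have *: "\<alpha> (inv (g i) \<otimes> x) = \<alpha> (inv (g j) \<otimes> y)" "\<sigma> i = \<sigma> j"
      by (simp_all add: LAS_apply[OF p])
    then have "i = j" using BijD(2)[OF pD(2)] xi yj by (auto dest: inj_onD)
    moreover have "inv (g i) \<otimes> x = inv (g j) \<otimes> y"
      using *(1) a(3) xi yj pD(4) by (auto dest!: inj_onD)
    ultimately show "x = y \<and> i = j" using xi yj pD(4)[of i] by simp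
  qed
  moreover have "?f ` mverts G m = mverts G m"
  proof (intro equalityI subsetI)
    fix v assume "v \<in> ?f ` mverts G m"
    then show "v \<in> mverts G m"
      using pD a(1) by (auto simp: LAS_apply[OF p] simp del: atLeastAtMost_iff)
  next
    fix v assume "v \<in> mverts G m"
    then obtain y j where v: "v = (y, j)" "y \<in> carrier G" "j \<in> {1..m}" by (cases v) simp
    obtain i where i: "i \<in> {1..m}" "j = \<sigma> i" using v BijD(3)[OF pD(2)] by blast
    obtain z where z: "z \<in> carrier G" "y = \<alpha> z" using v a(4) by blast
    have "inv (g i) \<otimes> (g i \<otimes> z) = z"
      using i z pD(4)[of i] by (simp flip: m_assoc)
    then have "?f (g i \<otimes> z, i) = v"
      using i z v pD(4)[of i] by (simp add: LAS_apply[OF p])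
    moreover have "(g i \<otimes> z, i) \<in> mverts G m" using i z pD(4)[of i] by simp
    ultimately show "v \<in> ?f ` mverts G m" by (metis imageI)
  qed
  moreover have "?f \<in> extensional (mverts G m)" by (simp add: LAS_eq[OF p])
  ultimately show ?thesis by (simp add: Bij_def bij_betw_def)
qed

text \<open>
  Left translations commute with right ones, hence only \<open>\<alpha>\<close> affects a right factor.
\<close>

lemma LAS_shift:
  assumes p: "parameters g \<alpha> \<sigma>" and "x \<in> carrier G" "a \<in> carrier G" "i \<in> {1..m}"
  shows "LAS G m g \<alpha> \<sigma> (x \<otimes> a, i) = (fst (LAS G m g \<alpha> \<sigma> (x, i)) \<otimes> \<alpha> a, \<sigma> i)"
  using assms parametersD[OF p] autoD(2)[of \<alpha> G "inv (g i) \<otimes> x" a]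
  by (simp add: LAS_apply[OF p] m_assoc)

lemma twist_image:
  assumes "i \<in> {1..m}" "j \<in> {1..m}" "g \<in> {1..m} \<rightarrow> carrier G"
  shows "twist G S g i j = (\<lambda>s. inv (g j) \<otimes> s \<otimes> g i) ` S i j"
  by (auto simp: twist_def l_coset_def r_coset_def)

text \<open>
  The quotient \<open>s\<close> of two vertices in copies \<open>i\<close> and \<open>j\<close> becomes
  \<open>\<alpha> (g\<^sub>j\<inverse> s g\<^sub>i)\<close>. This is a bijective function of \<open>s \<in> G\<close>, so preserving arcs in both
  directions means that it carries one connection set onto the other.
\<close>

lemma LAS_digraph_aut_iff:
  assumes p: "parameters g \<alpha> \<sigma>"
  shows "LAS G m g \<alpha> \<sigma> \<in> carrier A \<longleftrightarrow>
    (\<forall>i \<in> {1..m}. \<forall>j \<in> {1..m}. S (\<sigma> i) (\<sigma> j) = \<alpha> ` twist G S g i j)"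
proof -
  note pD = parametersD[OF p]
  note a = autoD[OF pD(1)]
  let ?f = "LAS G m g \<alpha> \<sigma>"
  let ?b = "\<lambda>i j s. \<alpha> (inv (g j) \<otimes> s \<otimes> g i)"
  have diff: "\<alpha> (inv (g j) \<otimes> y) \<otimes> inv (\<alpha> (inv (g i) \<otimes> x)) = ?b i j (y \<otimes> inv x)"
    if "i \<in> {1..m}" "j \<in> {1..m}" "x \<in> carrier G" "y \<in> carrier G" for i j x y
    using that pD(4)[of i] pD(4)[of j]
    by (simp add: auto_inv[OF pD(1)] a(2)[symmetric] inv_mult_group m_assoc flip: auto_inv[OF pD(1)])
  have "?f \<in> carrier A \<longleftrightarrow> (\<forall>i \<in> {1..m}. \<forall>j \<in> {1..m}. \<forall>x \<in> carrier G. \<forall>y \<in> carrier G.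
      ((x, i), (y, j)) \<in> parcs (mCay G m S) \<longleftrightarrow> (?f (x, i), ?f (y, j)) \<in> parcs (mCay G m S))"
    unfolding digraph_aut_def using LAS_Bij[OF p] by (auto simp: mverts_def block_def)
  also have "\<dots> \<longleftrightarrow> (\<forall>i \<in> {1..m}. \<forall>j \<in> {1..m}. \<forall>x \<in> carrier G. \<forall>y \<in> carrier G.
      y \<otimes> inv x \<in> S i j \<longleftrightarrow> ?b i j (y \<otimes> inv x) \<in> S (\<sigma> i) (\<sigma> j))"
    using pD(4,5) a(1)
    by (intro ball_cong refl) (simp add: LAS_apply[OF p] arc_iff diff del: atLeastAtMost_iff)
  \<comment> \<open>Every \<open>s\<close> is the quotient of the pair \<open>\<one>\<close>, \<open>s\<close>.\<close>
  also have "\<dots> \<longleftrightarrow> (\<forall>i \<in> {1..m}. \<forall>j \<in> {1..m}. \<forall>s \<in> carrier G.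
      s \<in> S i j \<longleftrightarrow> ?b i j s \<in> S (\<sigma> i) (\<sigma> j))"
  proof (rule ball_cong[OF refl], rule ball_cong[OF refl], rule iffI, rule ballI)
    fix i j s
    assume *: "\<forall>x \<in> carrier G. \<forall>y \<in> carrier G.
      y \<otimes> inv x \<in> S i j \<longleftrightarrow> ?b i j (y \<otimes> inv x) \<in> S (\<sigma> i) (\<sigma> j)" and s: "s \<in> carrier G"
    show "s \<in> S i j \<longleftrightarrow> ?b i j s \<in> S (\<sigma> i) (\<sigma> j)"
      using *[rule_format, OF one_closed s] s by simp
  qed simp
  also have "\<dots> \<longleftrightarrow> (\<forall>i \<in> {1..m}. \<forall>j \<in> {1..m}. S (\<sigma> i) (\<sigma> j) = ?b i j ` S i j)"
  proof (intro ball_cong refl)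
    fix i j assume ij: "i \<in> {1..m}" "j \<in> {1..m}"
    note g = pD(4)[OF ij(1)] pD(4)[OF ij(2)]
    have inj: "s = t" if "?b i j s = ?b i j t" "s \<in> carrier G" "t \<in> carrier G" for s t
      using that g inj_onD[OF a(3) that(1)] by simp
    have onto: "\<exists>s \<in> carrier G. t = ?b i j s" if t: "t \<in> carrier G" for t
    proof -
      obtain z where z: "z \<in> carrier G" "t = \<alpha> z" using t a(4) by blast
      have "inv (g j) \<otimes> (g j \<otimes> z) = z" using z g by (simp flip: m_assoc)
      then have "inv (g j) \<otimes> (g j \<otimes> z \<otimes> inv (g i)) \<otimes> g i = z"
        using z g by (simp add: m_assoc)
      then have "t = ?b i j (g j \<otimes> z \<otimes> inv (g i))" using z g by simp
      then show ?thesis using z g by blast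
    qed
    show "(\<forall>s \<in> carrier G. s \<in> S i j \<longleftrightarrow> ?b i j s \<in> S (\<sigma> i) (\<sigma> j)) \<longleftrightarrow>
        S (\<sigma> i) (\<sigma> j) = ?b i j ` S i j" (is "?L \<longleftrightarrow> ?R")
    proof
      assume ?L
      then show ?R
        using onto connD[OF ij] connD[OF pD(5)[OF ij(1)] pD(5)[OF ij(2)]] by blast
    next
      assume ?R
      then show ?L using inj connD[OF ij] by blast
    qed
  qed
  finally show ?thesis
    using pD(3) by (simp add: twist_image image_image)
qed

text \<open>
  Each of the explicit sets of the theorem consists of the automorphisms of the digraph among
  products of a given shape. In this form the equations on the connection sets no longer
  appear; the shapes without \<open>\<alpha>\<close> or without \<open>\<sigma>\<close> are those with an identity factor.
\<close>

lemma Ntilde_iff: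
  "f \<in> N \<longleftrightarrow> f \<in> carrier A \<and> (\<exists>g \<alpha> \<sigma>. parameters g \<alpha> \<sigma> \<and> f = LAS G m g \<alpha> \<sigma>)"
proof -
  have "f \<in> N \<longleftrightarrow> (\<exists>g \<alpha> \<sigma>. f = LAS G m g \<alpha> \<sigma> \<and> parameters g \<alpha> \<sigma> \<and>
     (\<forall>i \<in> {1..m}. \<forall>j \<in> {1..m}. S (\<sigma> i) (\<sigma> j) = \<alpha> ` twist G S g i j))"
    by (simp add: Ntilde_def parameters_def sym_gp_def conj_assoc)
  then have "f \<in> N \<longleftrightarrow> (\<exists>g \<alpha> \<sigma>. f = LAS G m g \<alpha> \<sigma> \<and>
     parameters g \<alpha> \<sigma> \<and> f \<in> carrier A)"
    by (simp only: LAS_digraph_aut_iff cong: conj_cong)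
  then show ?thesis by blast
qed

lemma Ktilde_iff:
  "f \<in> Ktilde G m S \<longleftrightarrow> f \<in> carrier A \<and>
     (\<exists>g \<alpha>. parameters g \<alpha> (\<lambda>i\<in>{1..m}. i) \<and> f = LAS G m g \<alpha> (\<lambda>i\<in>{1..m}. i))"
proof -
  define \<iota> where "\<iota> = (\<lambda>i\<in>{1..m}. i)"
  have "\<iota> \<in> Bij {1..m}" unfolding \<iota>_def by (rule id_Bij)
  moreover have "S i j = S (\<iota> i) (\<iota> j)" if "i \<in> {1..m}" "j \<in> {1..m}" for i j
    using that by (simp add: \<iota>_def)
  ultimately have "f \<in> Ktilde G m S \<longleftrightarrow> (\<exists>g \<alpha>. parameters g \<alpha> \<iota> \<and> f = LA G m g \<alpha> \<and>
     (\<forall>i \<in> {1..m}. \<forall>j \<in> {1..m}. S (\<iota> i) (\<iota> j) = \<alpha> ` twist G S g i j))"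
    by (simp add: Ktilde_def parameters_def conj_ac)
  moreover have "LA G m g \<alpha> = LAS G m g \<alpha> \<iota>" if "parameters g \<alpha> \<iota>" for g \<alpha>
    using that unfolding \<iota>_def parameters_def by (simp add: LA_eq_LAS)
  ultimately have "f \<in> Ktilde G m S \<longleftrightarrow> (\<exists>g \<alpha>. parameters g \<alpha> \<iota> \<and> f = LAS G m g \<alpha> \<iota> \<and> f \<in> carrier A)"
    by (simp only: LAS_digraph_aut_iff cong: conj_cong)
  then show ?thesis unfolding \<iota>_def by blast
qed

lemma Ctilde_iff:
  "f \<in> Ctilde G m S \<longleftrightarrow> f \<in> carrier A \<and>
     (\<exists>g \<sigma>. parameters g (\<lambda>x\<in>carrier G. x) \<sigma> \<and> f = LAS G m g (\<lambda>x\<in>carrier G. x) \<sigma>)"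
proof -
  define \<iota> where "\<iota> = (\<lambda>x\<in>carrier G. x)"
  have "\<iota> \<in> auto G" unfolding \<iota>_def by (rule id_in_auto)
  moreover have "\<iota> ` twist G S g i j = twist G S g i j"
    if "i \<in> {1..m}" "j \<in> {1..m}" "g \<in> {1..m} \<rightarrow> carrier G" for g i j
  proof -
    have "twist G S g i j \<subseteq> carrier G"
      using that connD[OF that(1,2)] by (auto simp: twist_image Pi_iff)
    then show ?thesis by (force simp: image_iff \<iota>_def)
  qed
  ultimately have "f \<in> Ctilde G m S \<longleftrightarrow> (\<exists>g \<sigma>. parameters g \<iota> \<sigma> \<and> f = LS G m g \<sigma> \<and>
     (\<forall>i \<in> {1..m}. \<forall>j \<in> {1..m}. S (\<sigma> i) (\<sigma> j) = \<iota> ` twist G S g i j))"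
    by (simp add: Ctilde_def parameters_def sym_gp_def conj_ac cong: conj_cong)
  moreover have "LS G m g \<sigma> = LAS G m g \<iota> \<sigma>" if "parameters g \<iota> \<sigma>" for g \<sigma>
    using that unfolding \<iota>_def parameters_def by (simp add: LS_eq_LAS)
  ultimately have "f \<in> Ctilde G m S \<longleftrightarrow> (\<exists>g \<sigma>. parameters g \<iota> \<sigma> \<and> f = LAS G m g \<iota> \<sigma> \<and> f \<in> carrier A)"
    by (simp only: LAS_digraph_aut_iff cong: conj_cong)
  then show ?thesis unfolding \<iota>_def by blast
qed

lemma Ntilde_vertex_iff:
  "f \<in> Ntilde_vertex G m S r \<longleftrightarrow> f \<in> carrier A \<and>
     (\<exists>g \<alpha> \<sigma>. parameters g \<alpha> \<sigma> \<and> g r = \<one> \<and> \<sigma> r = r \<and> f = LAS G m g \<alpha> \<sigma>)"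
proof -
  have "f \<in> Ntilde_vertex G m S r \<longleftrightarrow> (\<exists>g \<alpha> \<sigma>. f = LAS G m g \<alpha> \<sigma> \<and> parameters g \<alpha> \<sigma> \<and>
     g r = \<one> \<and> \<sigma> r = r \<and>
     (\<forall>i \<in> {1..m}. \<forall>j \<in> {1..m}. S (\<sigma> i) (\<sigma> j) = \<alpha> ` twist G S g i j))"
    by (simp add: Ntilde_vertex_def parameters_def sym_gp_def conj_assoc)
  then have "f \<in> Ntilde_vertex G m S r \<longleftrightarrow> (\<exists>g \<alpha> \<sigma>. f = LAS G m g \<alpha> \<sigma> \<and>
     parameters g \<alpha> \<sigma> \<and> g r = \<one> \<and> \<sigma> r = r \<and> f \<in> carrier A)"
    by (simp only: LAS_digraph_aut_iff cong: conj_cong)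
  then show ?thesis by blast
qed

lemma Ntilde_block_iff:
  "f \<in> Ntilde_block G m S r \<longleftrightarrow> f \<in> carrier A \<and>
     (\<exists>g \<alpha> \<sigma>. parameters g \<alpha> \<sigma> \<and> \<sigma> r = r \<and> f = LAS G m g \<alpha> \<sigma>)"
proof -
  have "f \<in> Ntilde_block G m S r \<longleftrightarrow> (\<exists>g \<alpha> \<sigma>. f = LAS G m g \<alpha> \<sigma> \<and> parameters g \<alpha> \<sigma> \<and> \<sigma> r = r \<and>
     (\<forall>i \<in> {1..m}. \<forall>j \<in> {1..m}. S (\<sigma> i) (\<sigma> j) = \<alpha> ` twist G S g i j))"
    by (simp add: Ntilde_block_def parameters_def sym_gp_def conj_assoc)
  then have "f \<in> Ntilde_block G m S r \<longleftrightarrow> (\<exists>g \<alpha> \<sigma>. f = LAS G m g \<alpha> \<sigma> \<and>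
     parameters g \<alpha> \<sigma> \<and> \<sigma> r = r \<and> f \<in> carrier A)"
    by (simp only: LAS_digraph_aut_iff cong: conj_cong)
  then show ?thesis by blast
qed

lemma Ktilde_vertex_iff:
  "f \<in> Ktilde_vertex G m S r \<longleftrightarrow> f \<in> carrier A \<and>
     (\<exists>g \<alpha>. parameters g \<alpha> (\<lambda>i\<in>{1..m}. i) \<and> g r = \<one> \<and> f = LAS G m g \<alpha> (\<lambda>i\<in>{1..m}. i))"
proof -
  define \<iota> where "\<iota> = (\<lambda>i\<in>{1..m}. i)"
  have "\<iota> \<in> Bij {1..m}" unfolding \<iota>_def by (rule id_Bij)
  moreover have "S i j = S (\<iota> i) (\<iota> j)" if "i \<in> {1..m}" "j \<in> {1..m}" for i j
    using that by (simp add: \<iota>_def)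
  ultimately have "f \<in> Ktilde_vertex G m S r \<longleftrightarrow> (\<exists>g \<alpha>. parameters g \<alpha> \<iota> \<and> f = LA G m g \<alpha> \<and> g r = \<one> \<and>
     (\<forall>i \<in> {1..m}. \<forall>j \<in> {1..m}. S (\<iota> i) (\<iota> j) = \<alpha> ` twist G S g i j))"
    by (simp add: Ktilde_vertex_def parameters_def conj_ac)
  moreover have "LA G m g \<alpha> = LAS G m g \<alpha> \<iota>" if "parameters g \<alpha> \<iota>" for g \<alpha>
    using that unfolding \<iota>_def parameters_def by (simp add: LA_eq_LAS)
  ultimately have "f \<in> Ktilde_vertex G m S r \<longleftrightarrow> (\<exists>g \<alpha>. parameters g \<alpha> \<iota> \<and> f = LAS G m g \<alpha> \<iota> \<and> g r = \<one> \<and> f \<in> carrier A)"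
    by (simp only: LAS_digraph_aut_iff cong: conj_cong)
  then show ?thesis unfolding \<iota>_def by blast
qed


section \<open>Normalizer and centralizer of the right regular representation\<close>

interpretation autgp: group A
  by (rule group_digraph_aut)

lemma carrier_A_Bij: "f \<in> carrier A \<Longrightarrow> f \<in> Bij (mverts G m)"
  by (simp add: digraph_aut_def)

lemma R_act_Bij:
  assumes "a \<in> carrier G"
  shows "R_act G m a \<in> Bij (mverts G m)"
proof -
  have "R_act G m a ` mverts G m = mverts G m"
  proof (intro equalityI subsetI)
    fix v assume "v \<in> mverts G m"
    then obtain x i where v: "v = (x, i)" "x \<in> carrier G" "i \<in> {1..m}" by (cases v) simp
    then have "v = R_act G m a (x \<otimes> inv a, i)" "(x \<otimes> inv a, i) \<in> mverts G m"
      using assms by (simp_all add: R_act_def m_assoc)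
    then show "v \<in> R_act G m a ` mverts G m" by blast
  qed (use assms in \<open>auto simp: R_act_def\<close>)
  moreover have "inj_on (R_act G m a) (mverts G m)"
    using assms by (auto simp: inj_on_def R_act_def)
  ultimately show ?thesis by (simp add: Bij_def bij_betw_def R_act_def)
qed

lemma R_act_in_A:
  assumes "a \<in> carrier G"
  shows "R_act G m a \<in> carrier A"
proof -
  have "(x \<otimes> a) \<otimes> inv (y \<otimes> a) = x \<otimes> inv y" if "x \<in> carrier G" "y \<in> carrier G" for x y
    using that assms by (simp add: inv_mult_group m_assoc) (simp flip: m_assoc)
  then have "(u, v) \<in> parcs (mCay G m S) \<longleftrightarrow> (R_act G m a u, R_act G m a v) \<in> parcs (mCay G m S)"
    if "u \<in> mverts G m" "v \<in> mverts G m" for u v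
    using that assms by (cases u; cases v) (simp add: R_act_def arc_iff)
  then show ?thesis
    using R_act_Bij[OF assms] by (simp add: digraph_aut_def)
qed

lemma R_act_mult:
  assumes "a \<in> carrier G" "b \<in> carrier G"
  shows "R_act G m a \<otimes>\<^bsub>A\<^esub> R_act G m b = R_act G m (a \<otimes> b)"
  using assms by (auto simp: fun_eq_iff compose_def R_act_def m_assoc)

lemma R_act_one: "R_act G m \<one> = \<one>\<^bsub>A\<^esub>"
  by (auto simp: fun_eq_iff R_act_def)

lemma RG_subgroup: "subgroup (RG G m) A"
proof (rule autgp.subgroupI)
  show "RG G m \<subseteq> carrier A" using R_act_in_A by (auto simp: RG_def)
  show "RG G m \<noteq> {}" by (auto simp: RG_def)
next
  fix f assume "f \<in> RG G m"
  then obtain a where a: "a \<in> carrier G" "f = R_act G m a" by (auto simp: RG_def)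
  then have "inv\<^bsub>A\<^esub> f = R_act G m (inv a)"
    using R_act_in_A by (intro autgp.inv_equality) (simp_all add: R_act_mult R_act_one del: digraph_aut_simps)
  then show "inv\<^bsub>A\<^esub> f \<in> RG G m" using a by (auto simp: RG_def)
next
  fix f h assume "f \<in> RG G m" "h \<in> RG G m"
  then show "f \<otimes>\<^bsub>A\<^esub> h \<in> RG G m"
    by (auto simp: RG_def R_act_mult simp del: digraph_aut_simps)
qed

lemma R_act_intertwine_iff:
  assumes "f \<in> Bij (mverts G m)" "a \<in> carrier G" "b \<in> carrier G"
  shows "R_act G m a \<otimes>\<^bsub>A\<^esub> f = f \<otimes>\<^bsub>A\<^esub> R_act G m b \<longleftrightarrow>
    (\<forall>x \<in> carrier G. \<forall>i \<in> {1..m}. f (x \<otimes> a, i) = (fst (f (x, i)) \<otimes> b, snd (f (x, i))))"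
proof -
  have "R_act G m a \<otimes>\<^bsub>A\<^esub> f = f \<otimes>\<^bsub>A\<^esub> R_act G m b \<longleftrightarrow>
    (\<forall>v \<in> mverts G m. f (R_act G m a v) = R_act G m b (f v))"
    by (auto simp: compose_def fun_eq_iff)
  also have "\<dots> \<longleftrightarrow> (\<forall>x \<in> carrier G. \<forall>i \<in> {1..m}. f (R_act G m a (x, i)) = R_act G m b (f (x, i)))"
    by (auto simp: mverts_def block_def)
  also have "\<dots> \<longleftrightarrow>
    (\<forall>x \<in> carrier G. \<forall>i \<in> {1..m}. f (x \<otimes> a, i) = (fst (f (x, i)) \<otimes> b, snd (f (x, i))))"
  proof (intro ball_cong refl)
    fix x i assume xi: "x \<in> carrier G" "i \<in> {1..m}"
    then have "f (x, i) \<in> mverts G m" using BijD(1)[OF assms(1), of "(x, i)"] by simp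
    then show "f (R_act G m a (x, i)) = R_act G m b (f (x, i)) \<longleftrightarrow>
        f (x \<otimes> a, i) = (fst (f (x, i)) \<otimes> b, snd (f (x, i)))"
      using xi by (cases "f (x, i)") (simp add: R_act_def)
  qed
  finally show ?thesis .
qed

lemma LAS_intertwines:
  assumes p: "parameters g \<alpha> \<sigma>" and a: "a \<in> carrier G"
  shows "R_act G m a \<otimes>\<^bsub>A\<^esub> LAS G m g \<alpha> \<sigma> = LAS G m g \<alpha> \<sigma> \<otimes>\<^bsub>A\<^esub> R_act G m (\<alpha> a)"
  using a autoD(1)[OF parametersD(1)[OF p]] LAS_shift[OF p _ a] LAS_apply[OF p]
  by (simp add: R_act_intertwine_iff[OF LAS_Bij[OF p]] del: digraph_aut_simps)

text \<open>
  From \<open>R(a) f = f R(\<alpha> a)\<close> and \<open>x = \<one> \<otimes> x\<close> one obtains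
  \<open>f (x, i) = (c\<^sub>i \<otimes> \<alpha> x, \<sigma> i)\<close> with \<open>(c\<^sub>i, \<sigma> i) = f (\<one>, i)\<close>. Multiplicativity of \<open>\<alpha>\<close> follows
  by cancelling \<open>c\<^sub>1\<close>, which uses that there is a first copy, injectivity from that of \<open>f\<close>,
  and surjectivity from the second hypothesis.
\<close>

lemma intertwining_imp_LAS:
  assumes f: "f \<in> Bij (mverts G m)"
    and fwd: "\<And>a. a \<in> carrier G \<Longrightarrow> \<exists>b \<in> carrier G. R_act G m a \<otimes>\<^bsub>A\<^esub> f = f \<otimes>\<^bsub>A\<^esub> R_act G m b"
    and bwd: "\<And>b. b \<in> carrier G \<Longrightarrow> \<exists>a \<in> carrier G. R_act G m a \<otimes>\<^bsub>A\<^esub> f = f \<otimes>\<^bsub>A\<^esub> R_act G m b"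
  shows "\<exists>g \<alpha> \<sigma>. parameters g \<alpha> \<sigma> \<and> f = LAS G m g \<alpha> \<sigma>"
proof -
  obtain \<phi> where \<phi>: "\<And>a. a \<in> carrier G \<Longrightarrow>
      \<phi> a \<in> carrier G \<and> R_act G m a \<otimes>\<^bsub>A\<^esub> f = f \<otimes>\<^bsub>A\<^esub> R_act G m (\<phi> a)"
    using fwd by metis
  define \<alpha> where "\<alpha> = restrict \<phi> (carrier G)"
  define c where "c i = fst (f (\<one>, i))" for i
  define \<sigma> where "\<sigma> = (\<lambda>i\<in>{1..m}. snd (f (\<one>, i)))"
  have fV: "f (x, i) \<in> mverts G m" if "x \<in> carrier G" "i \<in> {1..m}" for x i
    using that BijD(1)[OF f, of "(x, i)"] by simp
  have c: "c i \<in> carrier G" and \<sigma>: "\<sigma> i \<in> {1..m}" if "i \<in> {1..m}" for i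
    using fV[OF one_closed that] that by (cases "f (\<one>, i)", simp add: c_def \<sigma>_def)+
  have \<alpha>: "\<alpha> a \<in> carrier G" if "a \<in> carrier G" for a
    using \<phi> that by (simp add: \<alpha>_def)
  have shift: "f (x \<otimes> a, i) = (fst (f (x, i)) \<otimes> \<alpha> a, snd (f (x, i)))"
    if "x \<in> carrier G" "a \<in> carrier G" "i \<in> {1..m}" for x a i
    using that \<phi>[OF that(2)] R_act_intertwine_iff[OF f, of a "\<phi> a"] by (simp add: \<alpha>_def)
  have f_eq: "f (x, i) = (c i \<otimes> \<alpha> x, \<sigma> i)" if "x \<in> carrier G" "i \<in> {1..m}" for x i
    using shift[OF one_closed that] that by (simp add: c_def \<sigma>_def)
  have one_m: "1 \<in> {1..m}" using m_pos by simp
  have "\<alpha> \<in> hom G G"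
  proof (rule homI)
    fix a b assume ab: "a \<in> carrier G" "b \<in> carrier G"
    have "c 1 \<otimes> \<alpha> (a \<otimes> b) = c 1 \<otimes> (\<alpha> a \<otimes> \<alpha> b)"
      using shift[OF ab one_m] ab c[OF one_m] \<alpha> f_eq[OF _ one_m] by (simp add: m_assoc)
    then show "\<alpha> (a \<otimes> b) = \<alpha> a \<otimes> \<alpha> b"
      using ab c[OF one_m] \<alpha> by simp
  qed (rule \<alpha>)
  moreover have inj: "inj_on \<alpha> (carrier G)"
  proof (rule inj_onI)
    fix a b assume ab: "a \<in> carrier G" "b \<in> carrier G" "\<alpha> a = \<alpha> b"
    then have "f (a, 1) = f (b, 1)" using f_eq[OF _ one_m] by simp
    then show "a = b" using BijD(2)[OF f] ab one_m by (auto dest!: inj_onD)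
  qed
  moreover have surj: "\<alpha> ` carrier G = carrier G"
  proof (intro equalityI subsetI)
    fix b assume b: "b \<in> carrier G"
    then obtain a where a: "a \<in> carrier G" "R_act G m a \<otimes>\<^bsub>A\<^esub> f = f \<otimes>\<^bsub>A\<^esub> R_act G m b"
      using bwd by blast
    then have "f (\<one> \<otimes> a, 1) = (fst (f (\<one>, 1)) \<otimes> b, snd (f (\<one>, 1)))"
      using R_act_intertwine_iff[OF f a(1) b] one_m one_closed by blast
    then have "c 1 \<otimes> \<alpha> a = c 1 \<otimes> b"
      using f_eq[OF a(1) one_m] a by (simp add: c_def)
    then have "b = \<alpha> a" using b c[OF one_m] \<alpha>[OF a(1)] by simp
    then show "b \<in> \<alpha> ` carrier G" using a by blast
  qed (use \<alpha> in auto)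
  ultimately have auto: "\<alpha> \<in> auto G"
    by (simp add: auto_def Bij_def bij_betw_def \<alpha>_def)
  have "\<sigma> ` {1..m} = {1..m}"
  proof (intro equalityI subsetI)
    fix j assume "j \<in> {1..m}"
    then have "(\<one>, j) \<in> f ` mverts G m" using BijD(3)[OF f] by simp
    then obtain x i where "(\<one>, j) = f (x, i)" "x \<in> carrier G" "i \<in> {1..m}" by (auto simp: mverts_def block_def)
    then show "j \<in> \<sigma> ` {1..m}" using f_eq by auto
  qed (use \<sigma> in auto)
  moreover have "inj_on \<sigma> {1..m}"
    by (rule eq_card_imp_inj_on) (use calculation in simp_all)
  ultimately have Bij: "\<sigma> \<in> Bij {1..m}" by (simp add: Bij_def bij_betw_def \<sigma>_def)
  \<comment> \<open>The left translation by \<open>c\<^sub>i\<close> after \<open>\<alpha>\<close> is pulled back to one before \<open>\<alpha>\<close>.\<close>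
  define g where "g i = inv_into (carrier G) \<alpha> (inv (c i))" for i
  have g: "g i \<in> carrier G" "\<alpha> (inv (g i)) = c i" if "i \<in> {1..m}" for i
  proof -
    have "inv (c i) \<in> \<alpha> ` carrier G" using surj c[OF that] by simp
    then have *: "g i \<in> carrier G" "\<alpha> (g i) = inv (c i)"
      unfolding g_def by (auto intro: inv_into_into f_inv_into_f)
    then show "g i \<in> carrier G" "\<alpha> (inv (g i)) = c i"
      using c[OF that] by (simp_all add: auto_inv[OF auto])
  qed
  have p: "parameters g \<alpha> \<sigma>" using g Bij auto by (simp add: parameters_def)
  have "f = LAS G m g \<alpha> \<sigma>"
  proof (rule extensionalityI[of _ "mverts G m"])
    fix v assume "v \<in> mverts G m"
    then obtain x i where v: "v = (x, i)" "x \<in> carrier G" "i \<in> {1..m}" by (cases v) simp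
    show "f v = LAS G m g \<alpha> \<sigma> v"
      using v g[OF v(3)] by (simp add: LAS_apply[OF p] f_eq autoD(2)[OF auto])
  qed (use BijD(4)[OF f] BijD(4)[OF LAS_Bij[OF p]] in auto)
  with p show ?thesis by blast
qed

lemma normalizer_RG: "normalizer A (RG G m) = N"
proof (intro equalityI subsetI)
  have R: "RG G m \<subseteq> carrier A" using RG_subgroup by (rule subgroup.subset)
  fix f
  {
    assume "f \<in> normalizer A (RG G m)"
    then have f: "f \<in> carrier A" and eq: "f <#\<^bsub>A\<^esub> RG G m = RG G m #>\<^bsub>A\<^esub> f"
      using autgp.normalizer_iff_commutes[OF R] by auto
    have "\<exists>g \<alpha> \<sigma>. parameters g \<alpha> \<sigma> \<and> f = LAS G m g \<alpha> \<sigma>"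
    proof (rule intertwining_imp_LAS[OF carrier_A_Bij[OF f]])
      fix a assume "a \<in> carrier G"
      then have "R_act G m a \<otimes>\<^bsub>A\<^esub> f \<in> f <#\<^bsub>A\<^esub> RG G m"
        unfolding eq by (auto simp: r_coset_def RG_def)
      then show "\<exists>b \<in> carrier G. R_act G m a \<otimes>\<^bsub>A\<^esub> f = f \<otimes>\<^bsub>A\<^esub> R_act G m b"
        unfolding l_coset_def RG_def by blast
    next
      fix b assume "b \<in> carrier G"
      then have "f \<otimes>\<^bsub>A\<^esub> R_act G m b \<in> RG G m #>\<^bsub>A\<^esub> f"
        unfolding eq[symmetric] by (auto simp: l_coset_def RG_def)
      then show "\<exists>a \<in> carrier G. R_act G m a \<otimes>\<^bsub>A\<^esub> f = f \<otimes>\<^bsub>A\<^esub> R_act G m b"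
        unfolding r_coset_def RG_def by fastforce
    qed
    with f show "f \<in> N" by (simp add: Ntilde_iff)
  next
    assume "f \<in> N"
    then obtain g \<alpha> \<sigma> where f: "f \<in> carrier A" "parameters g \<alpha> \<sigma>" "f = LAS G m g \<alpha> \<sigma>"
      using Ntilde_iff by blast
    note int = LAS_intertwines[OF f(2), folded f(3)]
    \<comment> \<open>Surjectivity of \<open>\<alpha>\<close> lets \<open>\<alpha> a\<close> run through all of \<open>G\<close>.\<close>
    have "RG G m #>\<^bsub>A\<^esub> f = (\<lambda>a. f \<otimes>\<^bsub>A\<^esub> R_act G m (\<alpha> a)) ` carrier G"
      using int unfolding r_coset_def RG_def by (auto simp del: digraph_aut_simps)
    also have "\<dots> = (\<lambda>b. f \<otimes>\<^bsub>A\<^esub> R_act G m b) ` \<alpha> ` carrier G"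
      by (simp only: image_image)
    also have "\<dots> = f <#\<^bsub>A\<^esub> RG G m"
      unfolding autoD(4)[OF parametersD(1)[OF f(2)]] by (auto simp: l_coset_def RG_def)
    finally show "f \<in> normalizer A (RG G m)"
      using f(1) autgp.normalizer_iff_commutes[OF R] by auto
  }
qed

text \<open>
  Commuting with every \<open>R(a)\<close> means intertwining \<open>R(a)\<close> with \<open>R(\<alpha> a)\<close> for \<open>\<alpha> = id\<close>,
  because \<open>R\<close> is faithful.
\<close>

lemma centralizer_RG: "centralizer A (RG G m) = Ctilde G m S"
proof (intro equalityI subsetI)
  fix f
  {
    assume "f \<in> centralizer A (RG G m)"
    then have f: "f \<in> carrier A"
      and comm: "\<And>a. a \<in> carrier G \<Longrightarrow> R_act G m a \<otimes>\<^bsub>A\<^esub> f = f \<otimes>\<^bsub>A\<^esub> R_act G m a"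
      by (auto simp: centralizer_def RG_def simp del: digraph_aut_simps)
    obtain g \<alpha> \<sigma> where p: "parameters g \<alpha> \<sigma>" and f_eq: "f = LAS G m g \<alpha> \<sigma>"
      using intertwining_imp_LAS[OF carrier_A_Bij[OF f]] comm by blast
    have one_m: "1 \<in> {1..m}" using m_pos by simp
    have "\<alpha> a = a" if a: "a \<in> carrier G" for a
    proof -
      have "f \<otimes>\<^bsub>A\<^esub> R_act G m (\<alpha> a) = f \<otimes>\<^bsub>A\<^esub> R_act G m a"
        using comm[OF a] LAS_intertwines[OF p a] f_eq by simp
      then have "R_act G m (\<alpha> a) = R_act G m a"
        using f a R_act_in_A autoD(1)[OF parametersD(1)[OF p]]
        by (simp del: digraph_aut_simps)
      then have "R_act G m (\<alpha> a) (\<one>, 1) = R_act G m a (\<one>, 1)" by simp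
      then show ?thesis
        using a one_m autoD(1)[OF parametersD(1)[OF p] a] by (simp add: R_act_def)
    qed
    then have "\<alpha> = (\<lambda>x\<in>carrier G. x)"
      using autoD(5)[OF parametersD(1)[OF p]] by (auto simp: fun_eq_iff extensional_def)
    then show "f \<in> Ctilde G m S"
      using f p f_eq Ctilde_iff by blast
  next
    assume "f \<in> Ctilde G m S"
    then obtain g \<sigma> where f: "f \<in> carrier A" "parameters g (\<lambda>x\<in>carrier G. x) \<sigma>"
      "f = LAS G m g (\<lambda>x\<in>carrier G. x) \<sigma>"
      using Ctilde_iff by blast
    then show "f \<in> centralizer A (RG G m)"
      using LAS_intertwines[OF f(2)]
      by (auto simp: centralizer_def RG_def simp del: digraph_aut_simps)
  }
qed


section \<open>The actions on the blocks and on the group\<close>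

text \<open>
  The factors \<open>\<sigma>\<close> and \<open>\<alpha>\<close> recovered from the map alone: \<open>\<sigma>\<close> from the copies containing the
  images of the identity vertices, and \<open>\<alpha>\<close> by removing from the first copy the left
  translation by the image of its identity vertex.
\<close>

definition block_perm :: "('a \<times> nat \<Rightarrow> 'a \<times> nat) \<Rightarrow> nat \<Rightarrow> nat" where
  "block_perm f = (\<lambda>i\<in>{1..m}. snd (f (\<one>, i)))"

definition group_part :: "('a \<times> nat \<Rightarrow> 'a \<times> nat) \<Rightarrow> 'a \<Rightarrow> 'a" where
  "group_part f = (\<lambda>x\<in>carrier G. inv (fst (f (\<one>, 1))) \<otimes> fst (f (x, 1)))"

lemma block_perm_LAS:
  assumes p: "parameters g \<alpha> \<sigma>"
  shows "block_perm (LAS G m g \<alpha> \<sigma>) = \<sigma>"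
  using BijD(4)[OF parametersD(2)[OF p]]
  by (auto simp: fun_eq_iff block_perm_def LAS_apply[OF p] extensional_def)

lemma group_part_LAS:
  assumes p: "parameters g \<alpha> \<sigma>"
  shows "group_part (LAS G m g \<alpha> \<sigma>) = \<alpha>"
proof
  fix x
  have one_m: "1 \<in> {1..m}" using m_pos by simp
  note g = parametersD(4)[OF p one_m]
  note \<alpha> = autoD[OF parametersD(1)[OF p]]
  show "group_part (LAS G m g \<alpha> \<sigma>) x = \<alpha> x"
  proof (cases "x \<in> carrier G")
    case True
    then show ?thesis
      using g \<alpha>(1) one_m
      by (simp add: group_part_def LAS_apply[OF p] \<alpha>(2) auto_inv[OF parametersD(1)[OF p]])
         (simp flip: m_assoc)
  next
    case False
    then show ?thesis using \<alpha>(5) by (simp add: group_part_def extensional_def)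
  qed
qed

lemma NtildeE:
  assumes "f \<in> N"
  obtains g where "parameters g (group_part f) (block_perm f)"
    "f = LAS G m g (group_part f) (block_perm f)"
  using assms block_perm_LAS group_part_LAS Ntilde_iff by metis

lemma Ntilde_subgroup: "subgroup N A"
  using autgp.normalizer_imp_subgroup[OF subgroup.subset[OF RG_subgroup]]
  by (simp add: normalizer_RG)

lemma Ntilde_image:
  assumes f: "f \<in> N" and v: "v \<in> mverts G m"
  shows "f v \<in> mverts G m"
  using BijD(1)[OF carrier_A_Bij v] f Ntilde_iff by blast

lemma snd_Ntilde:
  assumes f: "f \<in> N" and v: "v \<in> mverts G m"
  shows "snd (f v) = block_perm f (snd v)"
proof -
  obtain g where "parameters g (group_part f) (block_perm f)"
    "f = LAS G m g (group_part f) (block_perm f)" using NtildeE[OF f] .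
  then show ?thesis using v LAS_apply by (cases v) (metis mverts_iff snd_conv)
qed

lemma Ntilde_fst_shift:
  assumes f: "f \<in> N" and xi: "x \<in> carrier G" "a \<in> carrier G" "i \<in> {1..m}"
  shows "fst (f (x \<otimes> a, i)) = fst (f (x, i)) \<otimes> group_part f a"
proof -
  obtain g where "parameters g (group_part f) (block_perm f)"
    "f = LAS G m g (group_part f) (block_perm f)" using NtildeE[OF f] .
  then show ?thesis using LAS_shift[OF _ xi] by (metis fst_conv)
qed

lemma block_perm_hom: "group_hom (A\<lparr>carrier := N\<rparr>) (sym_gp m) block_perm"
proof (intro group_hom.intro group_hom_axioms.intro homI)
  show "group (A\<lparr>carrier := N\<rparr>)" using Ntilde_subgroup by (rule autgp.subgroup_imp_group)
  show "group (sym_gp m)" unfolding sym_gp_def by (rule group_perm_group)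
next
  fix f assume "f \<in> carrier (A\<lparr>carrier := N\<rparr>)"
  then have "f \<in> N" by simp
  then show "block_perm f \<in> carrier (sym_gp m)"
    using NtildeE[of f] parametersD(2) by (metis perm_group_simps(1) sym_gp_def)
next
  fix f h assume "f \<in> carrier (A\<lparr>carrier := N\<rparr>)" "h \<in> carrier (A\<lparr>carrier := N\<rparr>)"
  then have fh: "f \<in> N" "h \<in> N" by simp_all
  have "snd (h (f (\<one>, i))) = block_perm h (snd (f (\<one>, i)))" if "i \<in> {1..m}" for i
    using fh that Ntilde_image[of f "(\<one>, i)"] by (simp add: snd_Ntilde)
  then show "block_perm (f \<otimes>\<^bsub>A\<lparr>carrier := N\<rparr>\<^esub> h) = block_perm f \<otimes>\<^bsub>sym_gp m\<^esub> block_perm h"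
    by (auto simp: fun_eq_iff sym_gp_def compose_def block_perm_def[of f]
        block_perm_def[of "\<lambda>v\<in>mverts G m. h (f v)"])
qed

text \<open>
  With \<open>f (\<one>, 1) = (y, j)\<close> and \<open>h (y, j) = (z, k)\<close>, the point \<open>(x, 1)\<close> goes to
  \<open>(y \<otimes> \<alpha> x, j)\<close> and then to \<open>(z \<otimes> \<beta> (\<alpha> x), k)\<close>, where \<open>\<alpha>\<close> and \<open>\<beta>\<close> belong to \<open>f\<close> and
  \<open>h\<close>. The composition can be read off in the first copy even if \<open>f\<close> moves that copy,
  since the same \<open>\<beta>\<close> governs all copies.
\<close>

lemma group_part_hom: "group_hom (A\<lparr>carrier := N\<rparr>) (aut_gp G) group_part"
proof (intro group_hom.intro group_hom_axioms.intro homI)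
  show "group (A\<lparr>carrier := N\<rparr>)" using Ntilde_subgroup by (rule autgp.subgroup_imp_group)
  show "group (aut_gp G)" by (rule group_aut_gp)
next
  fix f assume "f \<in> carrier (A\<lparr>carrier := N\<rparr>)"
  then have "f \<in> N" by simp
  then show "group_part f \<in> carrier (aut_gp G)"
    using NtildeE[of f] parametersD(1) by (metis aut_gp_simps(1))
next
  fix f h assume "f \<in> carrier (A\<lparr>carrier := N\<rparr>)" "h \<in> carrier (A\<lparr>carrier := N\<rparr>)"
  then have fh: "f \<in> N" "h \<in> N" by simp_all
  have one_m: "1 \<in> {1..m}" using m_pos by simp
  show "group_part (f \<otimes>\<^bsub>A\<lparr>carrier := N\<rparr>\<^esub> h) = group_part f \<otimes>\<^bsub>aut_gp G\<^esub> group_part h"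
  proof
    fix x
    show "group_part (f \<otimes>\<^bsub>A\<lparr>carrier := N\<rparr>\<^esub> h) x = (group_part f \<otimes>\<^bsub>aut_gp G\<^esub> group_part h) x"
    proof (cases "x \<in> carrier G")
      case x: True
      obtain g where p: "parameters g (group_part f) (block_perm f)" using NtildeE[OF fh(1)] .
      obtain g' where p': "parameters g' (group_part h) (block_perm h)" using NtildeE[OF fh(2)] .
      define a where "a = group_part f x"
      have a: "a \<in> carrier G" using autoD(1)[OF parametersD(1)[OF p] x] by (simp add: a_def)
      obtain y j where y: "f (\<one>, 1) = (y, j)" by (cases "f (\<one>, 1)")
      have yj: "y \<in> carrier G" "j \<in> {1..m}"
        using Ntilde_image[OF fh(1), of "(\<one>, 1)"] one_m y by simp_all
      have "fst (f (x, 1)) = y \<otimes> a"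
        using Ntilde_fst_shift[OF fh(1) one_closed x one_m] x y by (simp add: a_def)
      moreover have "snd (f (x, 1)) = j"
        using snd_Ntilde[OF fh(1)] x one_m y by (metis mverts_iff one_closed snd_conv)
      ultimately have fx: "f (x, 1) = (y \<otimes> a, j)" by (simp add: prod_eq_iff)
      obtain z k where z: "h (y, j) = (z, k)" by (cases "h (y, j)")
      have "z \<in> carrier G"
        using Ntilde_image[OF fh(2), of "(y, j)"] yj z by simp
      moreover have "fst (h (y \<otimes> a, j)) = z \<otimes> group_part h a"
        using Ntilde_fst_shift[OF fh(2) yj(1) a yj(2)] z by simp
      moreover have "group_part h a \<in> carrier G"
        using autoD(1)[OF parametersD(1)[OF p'] a] .
      ultimately have "inv (fst (h (f (\<one>, 1)))) \<otimes> fst (h (f (x, 1))) = group_part h a"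
        using y fx z by (simp flip: m_assoc)
      then show ?thesis
        using x one_m by (simp add: group_part_def[of "\<lambda>v\<in>mverts G m. h (f v)"] compose_def a_def)
    qed (simp add: group_part_def compose_def)
  qed
qed

lemma Ktilde_eq: "Ktilde G m S = {f \<in> N. block_perm f = (\<lambda>i\<in>{1..m}. i)}"
proof (intro equalityI subsetI)
  fix f assume "f \<in> Ktilde G m S"
  then show "f \<in> {f \<in> N. block_perm f = (\<lambda>i\<in>{1..m}. i)}"
    by (auto simp: Ktilde_iff Ntilde_iff block_perm_LAS)
next
  fix f assume f: "f \<in> {f \<in> N. block_perm f = (\<lambda>i\<in>{1..m}. i)}"
  then obtain g where "parameters g (group_part f) (block_perm f)"
    "f = LAS G m g (group_part f) (block_perm f)" using NtildeE[of f] by blast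
  with f show "f \<in> Ktilde G m S" unfolding Ktilde_iff Ntilde_iff by auto
qed

lemma Ctilde_eq: "Ctilde G m S = {f \<in> N. group_part f = (\<lambda>x\<in>carrier G. x)}"
proof (intro equalityI subsetI)
  fix f assume "f \<in> Ctilde G m S"
  then show "f \<in> {f \<in> N. group_part f = (\<lambda>x\<in>carrier G. x)}"
    by (auto simp: Ctilde_iff Ntilde_iff group_part_LAS)
next
  fix f assume f: "f \<in> {f \<in> N. group_part f = (\<lambda>x\<in>carrier G. x)}"
  then obtain g where "parameters g (group_part f) (block_perm f)"
    "f = LAS G m g (group_part f) (block_perm f)" using NtildeE[of f] by blast
  with f show "f \<in> Ctilde G m S" unfolding Ctilde_iff Ntilde_iff by auto
qed

lemma Sbar_eq: "Sbar G m S = block_perm ` N"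
proof (intro equalityI subsetI)
  fix \<sigma> assume "\<sigma> \<in> Sbar G m S"
  then obtain g \<alpha> where "parameters g \<alpha> \<sigma>" "LAS G m g \<alpha> \<sigma> \<in> N"
    by (auto simp: Sbar_def parameters_def sym_gp_def)
  then show "\<sigma> \<in> block_perm ` N" by (metis block_perm_LAS imageI)
next
  fix \<sigma> assume "\<sigma> \<in> block_perm ` N"
  then obtain f where f: "f \<in> N" "\<sigma> = block_perm f" by blast
  then obtain g where "parameters g (group_part f) \<sigma>" "f = LAS G m g (group_part f) \<sigma>"
    using NtildeE[of f] by blast
  with f have "parameters g (group_part f) \<sigma>" "LAS G m g (group_part f) \<sigma> \<in> N" by simp_all
  then show "\<sigma> \<in> Sbar G m S"
    unfolding Sbar_def parameters_def sym_gp_def perm_group_simps aut_gp_simps by blast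
qed

lemma Autbar_eq: "Autbar G m S = group_part ` N"
proof (intro equalityI subsetI)
  fix \<alpha> assume "\<alpha> \<in> Autbar G m S"
  then obtain g \<sigma> where "parameters g \<alpha> \<sigma>" "LAS G m g \<alpha> \<sigma> \<in> N"
    by (auto simp: Autbar_def parameters_def sym_gp_def)
  then show "\<alpha> \<in> group_part ` N" by (metis group_part_LAS imageI)
next
  fix \<alpha> assume "\<alpha> \<in> group_part ` N"
  then obtain f where f: "f \<in> N" "\<alpha> = group_part f" by blast
  then obtain g where "parameters g \<alpha> (block_perm f)" "f = LAS G m g \<alpha> (block_perm f)"
    using NtildeE[of f] by blast
  with f have "parameters g \<alpha> (block_perm f)" "LAS G m g \<alpha> (block_perm f) \<in> N" by simp_all
  then show "\<alpha> \<in> Autbar G m S"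
    unfolding Autbar_def parameters_def sym_gp_def perm_group_simps aut_gp_simps by blast
qed

lemma Ntilde_extension_Ktilde:
  "is_extension (A\<lparr>carrier := N\<rparr>) (Ktilde G m S) ((sym_gp m)\<lparr>carrier := Sbar G m S\<rparr>)"
proof -
  have "Ktilde G m S = kernel (A\<lparr>carrier := N\<rparr>) (sym_gp m) block_perm"
    by (simp add: Ktilde_eq kernel_def sym_gp_def)
  then show ?thesis
    using group_hom.kernel_extension[OF block_perm_hom] by (simp add: Sbar_eq)
qed

lemma Ntilde_extension_Ctilde:
  "is_extension (A\<lparr>carrier := N\<rparr>) (Ctilde G m S) ((aut_gp G)\<lparr>carrier := Autbar G m S\<rparr>)"
proof -
  have "Ctilde G m S = kernel (A\<lparr>carrier := N\<rparr>) (aut_gp G) group_part"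
    by (simp add: Ctilde_eq kernel_def)
  then show ?thesis
    using group_hom.kernel_extension[OF group_part_hom] by (simp add: Autbar_eq)
qed


section \<open>Stabilizers\<close>

text \<open>Blocks are nonempty, so that a block determines its index.\<close>

lemma block_inject: "block G i = block G j \<longleftrightarrow> i = j"
  using one_closed by (auto simp: block_def)

lemma image_block:
  assumes f: "f \<in> N" and i: "i \<in> {1..m}"
  shows "f ` block G i = block G (block_perm f i)"
proof (intro equalityI subsetI)
  fix v assume "v \<in> f ` block G i"
  then obtain u where u: "v = f u" "u \<in> mverts G m" "snd u = i"
    using i by (auto simp: block_def)
  then show "v \<in> block G (block_perm f i)"
    using Ntilde_image[OF f u(2)] snd_Ntilde[OF f u(2)] by (cases "f u") (simp add: block_def)
next
  fix v assume v: "v \<in> block G (block_perm f i)"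
  have B: "f \<in> Bij (mverts G m)" using f Ntilde_iff carrier_A_Bij by blast
  obtain g where p: "parameters g (group_part f) (block_perm f)" using NtildeE[OF f] .
  note bp = parametersD(2)[OF p]
  have "v \<in> mverts G m" using v parametersD(5)[OF p i] by (auto simp: block_def)
  then obtain u where u: "u \<in> mverts G m" "v = f u" using BijD(3)[OF B] by blast
  then have "block_perm f (snd u) = block_perm f i"
    using v snd_Ntilde[OF f u(1)] by (auto simp: block_def)
  then have "snd u = i" using BijD(2)[OF bp] i u(1) by (cases u) (auto dest: inj_onD)
  with u show "v \<in> f ` block G i" by (cases u) (auto simp: block_def)
qed

lemma block_action_in_Bij:
  assumes f: "f \<in> N"
  shows "block_action G m f \<in> Bij (blocks G m)"
proof -
  obtain g where "parameters g (group_part f) (block_perm f)" using NtildeE[OF f] .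
  note bp = BijD[OF parametersD(2)[OF this]]
  have *: "block_action G m f (block G i) = block G (block_perm f i)" if "i \<in> {1..m}" for i
    using that f by (simp add: block_action_def blocks_def image_block)
  have "inj_on (block_action G m f) (blocks G m)"
  proof (rule inj_onI)
    fix B C assume "B \<in> blocks G m" "C \<in> blocks G m"
      and eq: "block_action G m f B = block_action G m f C"
    then obtain i j where ij: "B = block G i" "C = block G j" "i \<in> {1..m}" "j \<in> {1..m}"
      unfolding blocks_def by blast
    then have "block_perm f i = block_perm f j" using eq by (simp only: * block_inject)
    then show "B = C" using inj_onD[OF bp(2)] ij by blast
  qed
  moreover have "block_action G m f ` blocks G m = block G ` block_perm f ` {1..m}"
    unfolding blocks_def image_image by (rule image_cong) (use * in auto)
  moreover have "block_action G m f \<in> extensional (blocks G m)" by (simp add: block_action_def)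
  ultimately show ?thesis
    unfolding bp(3) blocks_def[symmetric] by (simp add: Bij_def bij_betw_def)
qed

lemma block_action_hom:
  "block_action G m \<in> hom (A\<lparr>carrier := N\<rparr>) (perm_group (blocks G m))"
proof (rule homI)
  fix f h assume "f \<in> carrier (A\<lparr>carrier := N\<rparr>)" "h \<in> carrier (A\<lparr>carrier := N\<rparr>)"
  then have f: "f \<in> N" by simp
  have "compose (mverts G m) h f ` B = h ` f ` B" and "f ` B \<in> blocks G m"
    if B: "B \<in> blocks G m" for B
  proof -
    have "B \<subseteq> mverts G m" using B by (auto simp: blocks_def mverts_def)
    then show "compose (mverts G m) h f ` B = h ` f ` B"
      unfolding image_image by (intro image_cong) (auto simp: compose_def)
    show "f ` B \<in> blocks G m"
      using BijD(1)[OF block_action_in_Bij[OF f] B] B by (simp add: block_action_def)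
  qed
  then show "block_action G m (f \<otimes>\<^bsub>A\<lparr>carrier := N\<rparr>\<^esub> h) =
      block_action G m f \<otimes>\<^bsub>perm_group (blocks G m)\<^esub> block_action G m h"
    by (auto simp: fun_eq_iff block_action_def compose_def)
qed (simp add: block_action_in_Bij)

lemma block_action_kernel:
  "kernel (A\<lparr>carrier := N\<rparr>) (perm_group (blocks G m)) (block_action G m) = Ktilde G m S"
proof -
  have "block_action G m f = (\<lambda>B\<in>blocks G m. B) \<longleftrightarrow> block_perm f = (\<lambda>i\<in>{1..m}. i)"
    if f: "f \<in> N" for f
  proof -
    have "block_action G m f = (\<lambda>B\<in>blocks G m. B) \<longleftrightarrow> (\<forall>i \<in> {1..m}. f ` block G i = block G i)"
      by (auto simp: fun_eq_iff block_action_def blocks_def)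
    also have "\<dots> \<longleftrightarrow> (\<forall>i \<in> {1..m}. block_perm f i = i)"
      using f by (simp add: image_block block_inject)
    also have "\<dots> \<longleftrightarrow> block_perm f = (\<lambda>i\<in>{1..m}. i)"
      by (auto simp: fun_eq_iff block_perm_def)
    finally show ?thesis .
  qed
  then show ?thesis by (auto simp: Ktilde_eq kernel_def)
qed

lemma LAS_fixes_iff:
  assumes p: "parameters g \<alpha> \<sigma>" and r: "r \<in> {1..m}"
  shows "LAS G m g \<alpha> \<sigma> (\<one>, r) = (\<one>, r) \<longleftrightarrow> g r = \<one> \<and> \<sigma> r = r"
proof -
  note g = parametersD(4)[OF p r]
  have "\<alpha> (inv (g r)) = \<one> \<longleftrightarrow> inv (g r) = \<one>"
    using inj_on_eq_iff[OF autoD(3)[OF parametersD(1)[OF p]], of "inv (g r)" \<one>]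
      auto_inv(2)[OF parametersD(1)[OF p] one_closed] g by simp
  also have "\<dots> \<longleftrightarrow> g r = \<one>" using g by simp
  finally show ?thesis using r g by (simp add: LAS_apply[OF p])
qed

lemma Ntilde_vertex_eq:
  assumes r: "r \<in> {1..m}"
  shows "Ntilde_vertex G m S r = {f \<in> N. f (\<one>, r) = (\<one>, r)}"
proof (intro equalityI subsetI)
  fix f assume "f \<in> Ntilde_vertex G m S r"
  then obtain g \<alpha> \<sigma> where "f \<in> carrier A" "parameters g \<alpha> \<sigma>" "g r = \<one>" "\<sigma> r = r"
    "f = LAS G m g \<alpha> \<sigma>"
    unfolding Ntilde_vertex_iff by blast
  moreover from this have "f \<in> N" unfolding Ntilde_iff by blast
  ultimately show "f \<in> {f \<in> N. f (\<one>, r) = (\<one>, r)}"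
    using r by (simp add: LAS_fixes_iff)
next
  fix f assume "f \<in> {f \<in> N. f (\<one>, r) = (\<one>, r)}"
  then obtain g \<alpha> \<sigma> where "f \<in> carrier A" "parameters g \<alpha> \<sigma>"
    "f = LAS G m g \<alpha> \<sigma>" "f (\<one>, r) = (\<one>, r)"
    unfolding Ntilde_iff by blast
  moreover from this have "g r = \<one>" "\<sigma> r = r" using LAS_fixes_iff r by blast+
  ultimately show "f \<in> Ntilde_vertex G m S r" unfolding Ntilde_vertex_iff by blast
qed

lemma Ktilde_vertex_eq:
  assumes r: "r \<in> {1..m}"
  shows "Ktilde_vertex G m S r = {f \<in> Ktilde G m S. f (\<one>, r) = (\<one>, r)}"
proof (intro equalityI subsetI)
  fix f assume "f \<in> Ktilde_vertex G m S r"
  then obtain g \<alpha> where "f \<in> carrier A" "parameters g \<alpha> (\<lambda>i\<in>{1..m}. i)" "g r = \<one>"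
    "f = LAS G m g \<alpha> (\<lambda>i\<in>{1..m}. i)"
    unfolding Ktilde_vertex_iff by blast
  moreover from this have "f \<in> Ktilde G m S" unfolding Ktilde_iff by blast
  ultimately show "f \<in> {f \<in> Ktilde G m S. f (\<one>, r) = (\<one>, r)}"
    using r by (simp add: LAS_fixes_iff)
next
  fix f assume "f \<in> {f \<in> Ktilde G m S. f (\<one>, r) = (\<one>, r)}"
  then obtain g \<alpha> where "f \<in> carrier A" "parameters g \<alpha> (\<lambda>i\<in>{1..m}. i)"
    "f = LAS G m g \<alpha> (\<lambda>i\<in>{1..m}. i)" "f (\<one>, r) = (\<one>, r)"
    unfolding Ktilde_iff by blast
  moreover from this have "g r = \<one>" using LAS_fixes_iff r by blast
  ultimately show "f \<in> Ktilde_vertex G m S r" unfolding Ktilde_vertex_iff by blast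
qed

lemma Ntilde_block_eq: "Ntilde_block G m S r = {f \<in> N. block_perm f r = r}"
proof (intro equalityI subsetI)
  fix f assume "f \<in> Ntilde_block G m S r"
  then show "f \<in> {f \<in> N. block_perm f r = r}"
    by (auto simp: Ntilde_block_iff Ntilde_iff block_perm_LAS)
next
  fix f assume f: "f \<in> {f \<in> N. block_perm f r = r}"
  then obtain g where "parameters g (group_part f) (block_perm f)"
    "f = LAS G m g (group_part f) (block_perm f)" using NtildeE[of f] by blast
  with f show "f \<in> Ntilde_block G m S r" unfolding Ntilde_block_iff Ntilde_iff by auto
qed

lemma Ntilde_block_stabilizer:
  assumes r: "r \<in> {1..m}"
  shows "Ntilde_block G m S r = {f \<in> N. f ` block G r = block G r}"
  using r by (simp add: Ntilde_block_eq image_block block_inject cong: conj_cong)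


section \<open>Semidirect products\<close>

lemma RG_normal_Ntilde: "RG G m \<lhd> A\<lparr>carrier := N\<rparr>"
  using autgp.subgroup_in_normalizer[OF RG_subgroup] by (simp add: normalizer_RG)

lemma RG_subset_Ktilde: "RG G m \<subseteq> Ktilde G m S"
proof
  fix f assume f: "f \<in> RG G m"
  then have "f \<in> N"
    using subgroup.subset[OF normal_imp_subgroup[OF RG_normal_Ntilde]] by auto
  moreover have "block_perm f = (\<lambda>i\<in>{1..m}. i)"
    using f by (auto simp: RG_def block_perm_def R_act_def fun_eq_iff)
  ultimately show "f \<in> Ktilde G m S" by (simp add: Ktilde_eq)
qed

text \<open>
  Both semidirect decompositions are instances of this one, with the kernel of the action on
  the blocks and with the stabilizer of one block. If \<open>f\<close> fixes the block \<open>r\<close>, some \<open>b\<close> has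
  \<open>f (b, r) = (\<one>, r)\<close>; then \<open>R(b) f\<close> fixes \<open>(\<one>, r)\<close> and \<open>f = R(b\<inverse>) (R(b) f)\<close>. The
  intersection is trivial because only \<open>R(\<one>)\<close> fixes \<open>(\<one>, r)\<close>.
\<close>

lemma semidirect_vertex_stabilizer:
  assumes X: "subgroup X (A\<lparr>carrier := N\<rparr>)" and RX: "RG G m \<subseteq> X"
    and r: "r \<in> {1..m}" and fix_r: "\<And>f. f \<in> X \<Longrightarrow> block_perm f r = r"
  shows "internal_semidirect (A\<lparr>carrier := X\<rparr>) (RG G m) {f \<in> X. f (\<one>, r) = (\<one>, r)}"
proof -
  have XN: "X \<subseteq> N" using subgroup.subset[OF X] by simp
  have XA: "subgroup X A" by (rule autgp.incl_subgroup[OF Ntilde_subgroup X])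
  interpret X: group "A\<lparr>carrier := X\<rparr>" by (rule autgp.subgroup_imp_group[OF XA])
  interpret Ngp: group "A\<lparr>carrier := N\<rparr>" by (rule autgp.subgroup_imp_group[OF Ntilde_subgroup])
  have vr: "(\<one>, r) \<in> mverts G m" using r by simp
  let ?Z = "{f \<in> X. f (\<one>, r) = (\<one>, r)}"
  have "RG G m \<lhd> A\<lparr>carrier := X\<rparr>"
    using Ngp.normal_restrict_supergroup[OF X RG_normal_Ntilde RX] by simp
  moreover have "subgroup ?Z (A\<lparr>carrier := X\<rparr>)"
  proof (rule X.subgroupI)
    show "?Z \<noteq> {}"
      using X.one_closed vr by (auto intro!: exI[of _ "\<one>\<^bsub>A\<^esub>"])
  next
    fix f assume f: "f \<in> ?Z"
    let ?h = "inv\<^bsub>A\<lparr>carrier := X\<rparr>\<^esub> f"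
    have "f \<otimes>\<^bsub>A\<lparr>carrier := X\<rparr>\<^esub> ?h = \<one>\<^bsub>A\<lparr>carrier := X\<rparr>\<^esub>" using f by (intro X.r_inv) simp
    then have "compose (mverts G m) ?h f (\<one>, r) = (\<one>, r)"
      using vr by simp
    then have "?h (\<one>, r) = (\<one>, r)" using f vr by (simp add: compose_def)
    then show "?h \<in> ?Z" using f X.inv_closed[of f] by simp
  next
    fix f h assume "f \<in> ?Z" "h \<in> ?Z"
    then show "f \<otimes>\<^bsub>A\<lparr>carrier := X\<rparr>\<^esub> h \<in> ?Z"
      using X.m_closed[of f h] vr by (simp add: compose_def)
  qed simp
  moreover have "RG G m \<inter> ?Z = {\<one>\<^bsub>A\<lparr>carrier := X\<rparr>\<^esub>}"
  proof -
    have "f = \<one>\<^bsub>A\<^esub>" if f: "f \<in> RG G m" "f (\<one>, r) = (\<one>, r)" for f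
    proof -
      obtain a where "a \<in> carrier G" "f = R_act G m a" using f(1) by (auto simp: RG_def)
      moreover from this have "a = \<one>" using f(2) vr by (simp add: R_act_def)
      ultimately show ?thesis by (simp only: R_act_one)
    qed
    moreover have "\<one>\<^bsub>A\<^esub> \<in> RG G m" using RG_subgroup by (rule subgroup.one_closed)
    moreover have "\<one>\<^bsub>A\<^esub> \<in> ?Z" using X.one_closed vr by simp
    ultimately have "RG G m \<inter> ?Z = {\<one>\<^bsub>A\<^esub>}" by blast
    then show ?thesis by simp
  qed
  moreover have "RG G m <#>\<^bsub>A\<lparr>carrier := X\<rparr>\<^esub> ?Z = carrier (A\<lparr>carrier := X\<rparr>)"
  proof (intro equalityI subsetI)
    fix f assume "f \<in> RG G m <#>\<^bsub>A\<lparr>carrier := X\<rparr>\<^esub> ?Z"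
    then obtain y z where yz: "y \<in> X" "z \<in> X" "f = y \<otimes>\<^bsub>A\<lparr>carrier := X\<rparr>\<^esub> z"
      using RX unfolding set_mult_def by blast
    then show "f \<in> carrier (A\<lparr>carrier := X\<rparr>)" using X.m_closed[of y z] by simp
  next
    fix f assume "f \<in> carrier (A\<lparr>carrier := X\<rparr>)"
    then have f: "f \<in> X" by simp
    then have "(\<one>, r) \<in> f ` block G r"
      using image_block[of f r] XN r fix_r[OF f] by (auto simp: block_def)
    then obtain b where b: "b \<in> carrier G" "f (b, r) = (\<one>, r)" by (auto simp: block_def)
    let ?z = "R_act G m b \<otimes>\<^bsub>A\<^esub> f"
    have RbX: "R_act G m b \<in> X" "R_act G m (inv b) \<in> X" using b RX by (auto simp: RG_def)
    have "?z \<in> X" using X.m_closed[of "R_act G m b" f] RbX f by simp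
    moreover have "?z (\<one>, r) = (\<one>, r)" using b r by (simp add: compose_def R_act_def)
    moreover have "R_act G m (inv b) \<otimes>\<^bsub>A\<^esub> ?z = f"
    proof -
      have "R_act G m (inv b) \<otimes>\<^bsub>A\<^esub> ?z = \<one>\<^bsub>A\<^esub> \<otimes>\<^bsub>A\<^esub> f"
        using f b R_act_in_A subgroup.subset[OF XA]
        by (subst autgp.m_assoc[symmetric])
          (auto simp: R_act_mult R_act_one simp del: digraph_aut_simps)
      then show ?thesis
        using f subgroup.subset[OF XA] by (auto simp del: digraph_aut_simps)
    qed
    moreover have "R_act G m (inv b) \<in> RG G m" using b by (simp add: RG_def)
    ultimately show "f \<in> RG G m <#>\<^bsub>A\<lparr>carrier := X\<rparr>\<^esub> ?Z"
      unfolding set_mult_def by force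
  qed
  ultimately show ?thesis by (simp only: internal_semidirect_def)
qed

lemma Ktilde_semidirect:
  assumes r: "r \<in> {1..m}"
  shows "internal_semidirect (A\<lparr>carrier := Ktilde G m S\<rparr>) (RG G m) (Ktilde_vertex G m S r)"
  unfolding Ktilde_vertex_eq[OF r]
proof (rule semidirect_vertex_stabilizer[OF _ _ r])
  show "subgroup (Ktilde G m S) (A\<lparr>carrier := N\<rparr>)"
    using Ntilde_extension_Ktilde by (simp add: is_extension_def normal_imp_subgroup)
  show "RG G m \<subseteq> Ktilde G m S" by (rule RG_subset_Ktilde)
  show "block_perm f r = r" if "f \<in> Ktilde G m S" for f
    using that r by (simp add: Ktilde_eq)
qed

lemma Ntilde_block_semidirect:
  assumes r: "r \<in> {1..m}"
  shows "internal_semidirect (A\<lparr>carrier := Ntilde_block G m S r\<rparr>) (RG G m) (Ntilde_vertex G m S r)"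
proof -
  interpret bp: group_hom "A\<lparr>carrier := N\<rparr>" "sym_gp m" block_perm by (rule block_perm_hom)
  have "block_perm f r = r" if "f \<in> N" "f (\<one>, r) = (\<one>, r)" for f
    using snd_Ntilde[OF that(1), of "(\<one>, r)"] that(2) r by simp
  then have "Ntilde_vertex G m S r = {f \<in> Ntilde_block G m S r. f (\<one>, r) = (\<one>, r)}"
    using r by (auto simp: Ntilde_vertex_eq Ntilde_block_eq)
  moreover have "internal_semidirect (A\<lparr>carrier := Ntilde_block G m S r\<rparr>) (RG G m)
      {f \<in> Ntilde_block G m S r. f (\<one>, r) = (\<one>, r)}"
  proof (rule semidirect_vertex_stabilizer[OF _ _ r])
    show "subgroup (Ntilde_block G m S r) (A\<lparr>carrier := N\<rparr>)"
      unfolding Ntilde_block_eq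
    proof (rule bp.G.subgroupI)
      show "{f \<in> N. block_perm f r = r} \<noteq> {}"
        using bp.G.one_closed bp.hom_one r by (auto simp: sym_gp_def)
    next
      fix f assume f: "f \<in> {f \<in> N. block_perm f r = r}"
      let ?h = "inv\<^bsub>A\<lparr>carrier := N\<rparr>\<^esub> f"
      have "block_perm f \<otimes>\<^bsub>sym_gp m\<^esub> block_perm ?h = \<one>\<^bsub>sym_gp m\<^esub>"
        using f by simp
      then have "compose {1..m} (block_perm ?h) (block_perm f) r = r"
        using r by (simp add: sym_gp_def)
      then have "block_perm ?h r = r" using f r by (simp add: compose_def)
      then show "?h \<in> {f \<in> N. block_perm f r = r}" using f bp.G.inv_closed[of f] by simp
    next
      fix f h assume "f \<in> {f \<in> N. block_perm f r = r}" "h \<in> {f \<in> N. block_perm f r = r}"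
      then show "f \<otimes>\<^bsub>A\<lparr>carrier := N\<rparr>\<^esub> h \<in> {f \<in> N. block_perm f r = r}"
        using bp.hom_mult[of f h] bp.G.m_closed[of f h] r by (simp add: sym_gp_def compose_def)
    qed simp
    show "RG G m \<subseteq> Ntilde_block G m S r"
      using RG_subset_Ktilde r by (auto simp: Ktilde_eq Ntilde_block_eq)
    show "block_perm f r = r" if "f \<in> Ntilde_block G m S r" for f
      using that by (simp add: Ntilde_block_eq)
  qed
  ultimately show ?thesis by simp
qed

end

theorem theorem3p1:
  fixes G :: "('a, 'b) monoid_scheme" and m :: nat and S :: "nat \<Rightarrow> nat \<Rightarrow> 'a set"
    and \<Gamma> :: "('a \<times> nat) pair_pre_digraph" and A :: "('a \<times> nat \<Rightarrow> 'a \<times> nat) monoid"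
  assumes "group G" and "finite (carrier G)" and "m \<ge> 1"
    and "connection_sets G m S"
    and "\<Gamma> = mCay G m S"
    and "A = digraph_aut \<Gamma>"
  shows
    "(normalizer A (RG G m) = Ntilde G m S \<and>
      centralizer A (RG G m) = Ctilde G m S \<and>
      block_action G m \<in> hom (A\<lparr>carrier := Ntilde G m S\<rparr>) (perm_group (blocks G m)) \<and>
      kernel (A\<lparr>carrier := Ntilde G m S\<rparr>) (perm_group (blocks G m)) (block_action G m) = Ktilde G m S)
     \<and>
     (\<forall>r \<in> {1..m}.
        Ktilde_vertex G m S r = stabilizer (A\<lparr>carrier := Ktilde G m S\<rparr>) (\<lambda>f v. f v) (\<one>\<^bsub>G\<^esub>, r) \<and>
        Ntilde_vertex G m S r = stabilizer (A\<lparr>carrier := Ntilde G m S\<rparr>) (\<lambda>f v. f v) (\<one>\<^bsub>G\<^esub>, r) \<and>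
        Ntilde_block G m S r = stabilizer (A\<lparr>carrier := Ntilde G m S\<rparr>) (\<lambda>f B. f ` B) (block G r))
     \<and>
     ((\<forall>r \<in> {1..m}.
        internal_semidirect (A\<lparr>carrier := Ktilde G m S\<rparr>) (RG G m) (Ktilde_vertex G m S r) \<and>
        internal_semidirect (A\<lparr>carrier := Ntilde_block G m S r\<rparr>) (RG G m) (Ntilde_vertex G m S r)) \<and>
      is_extension (A\<lparr>carrier := Ntilde G m S\<rparr>) (Ktilde G m S) ((sym_gp m)\<lparr>carrier := Sbar G m S\<rparr>) \<and>
      is_extension (A\<lparr>carrier := Ntilde G m S\<rparr>) (Ctilde G m S) ((aut_gp G)\<lparr>carrier := Autbar G m S\<rparr>))"
proof -
  interpret m_cayley G m S
    using assms by (intro m_cayley.intro m_cayley_axioms.intro)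
  show ?thesis
    unfolding \<open>A = digraph_aut \<Gamma>\<close> \<open>\<Gamma> = mCay G m S\<close>
    using normalizer_RG centralizer_RG block_action_hom block_action_kernel
      Ntilde_extension_Ktilde Ntilde_extension_Ctilde
    by (simp add: stabilizer_def Ktilde_vertex_eq[symmetric] Ntilde_vertex_eq[symmetric]
        Ntilde_block_stabilizer[symmetric] Ktilde_semidirect Ntilde_block_semidirect
        del: atLeastAtMost_iff)
qed

end
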